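(* There is a unique hermitian structure $(\cdot,\cdot)$ on ${}_D\mathbf W$ such that $(\mathbf 1,\mathbf 1)=1$ and such that for all $\chi,\psi\in{}_D\mathbf W$: (i) for $z\in D$, as an equality of meromorphic sections of $K$ on $D$, $(\chi,e(z)\psi)=-C^*(i(C(z))\chi,\psi)$, or equivalently $u(z)^2(\chi,\hat e(z)\psi)=(\hat i(C(z))\chi,\psi)$; (ii) for $z'\in D'$, as an equality of meromorphic sections of $K$ on $D'$, $(\chi,i(z')\psi)=-C^*(e(C(z'))\chi,\psi)$, or equivalently $u(z')^2(\chi,\hat i(z')\psi)=(\hat e(C(z'))\chi,\psi)$.
   Context: $\mathbb P$ is a complex projective line with canonical bundle $K$, and $C:\mathbb P\to\mathbb P$ is an antiholomorphic involution given in a suitable coordinate $u$ (a meromorphic function with one simple pole) by $u(C(z))=1/\overline{u(z)}$. $P$ is the pole of $u$; $D'$ is the component of the complement of the fixed-point set of $C$ that contains $P$, and $D=C(D')$ is the other component, so $D=\{|u|<1\}$. ${}_D\mathbf K$ is the space of meromorphic 1-forms on $\mathbb P$ with all residues zero and all poles in $D$; ${}_D\mathbf W=S^*({}_D\mathbf K)$ is its symmetric algebra, with vacuum $\mathbf 1=1\in\mathbb C$. A hermitian structure is antilinear in the first argument and linear in the second. For $z\in D$, $e(z):{}_D\mathbf W\to{}_D\mathbf W\otimes K_z$ is multiplication by $e_z=-\frac{du}{(u-u(z))^2}\otimes du_z$, where $K_z$ is the fibre of $K$ at $z$. For $z\notin D$, $i(z):{}_D\mathbf W\to{}_D\mathbf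 W\otimes K_z$ is the derivation with $i(z)\mathbf 1=0$ and $i(z)\alpha=-\alpha(z)$ for $\alpha\in{}_D\mathbf K$. One writes $e(z)=\hat e(z)\,du_z$ and $i(z)=\hat i(z)\,du_z$. $C^*$ is pull-back by $C$, taking $(0,1)$-covectors at $C(z)$ to $(1,0)$-covectors at $z$.
   Formalization: Equality of sections in (i), (ii) is taken to include that pairing with the family e(z)ψ (resp. e(C(z'))χ) can be expanded termwise in Taylor series at each point of D; with equality of values only, uniqueness fails, since the e_z span only forms with double poles. *)

theory Defs
  imports "HOL-Complex_Analysis.Complex_Analysis" "HOL-Library.Poly_Mapping"
begin

section \<open>The projective line and its antiholomorphic involution\<close>

text \<open>
  The projective line is identified with \<open>\<complex> \<union> {\<infinity>}\<close> by the coordinate \<open>u\<close>: the point \<open>Pt a\<close> has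
  \<open>u = a\<close>, and \<open>Pole\<close> is the pole \<open>P\<close> of \<open>u\<close>. Near \<open>Pole\<close> the coordinate \<open>v = 1/u\<close> is used. The
  involution has fixed-point set \<open>|u| = 1\<close>, whose complement has the components \<open>D\<close> and \<open>D'\<close>.
\<close>

datatype pline = Pt complex | Pole

fun u_coord :: "pline \<Rightarrow> complex" where
  "u_coord (Pt a) = a"
| "u_coord Pole = 0"  \<comment> \<open>junk value\<close>

fun v_coord :: "pline \<Rightarrow> complex" where
  "v_coord (Pt a) = 1 / a"  \<comment> \<open>junk value at \<open>a = 0\<close>\<close>
| "v_coord Pole = 0"

definition v_point :: "complex \<Rightarrow> pline" where
  "v_point t = (if t = 0 then Pole else Pt (1 / t))"

fun Cinv :: "pline \<Rightarrow> pline" where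
  "Cinv (Pt a) = (if a = 0 then Pole else Pt (1 / cnj a))"
| "Cinv Pole = Pt 0"

definition discD :: "pline set" where
  "discD = {Pt a |a. norm a < 1}"

definition discD' :: "pline set" where
  "discD' = insert Pole {Pt a |a. norm a > 1}"

lemma Cinv_Cinv [simp]: "Cinv (Cinv z) = z"
  by (cases z) auto

lemma Cinv_discD: "Cinv ` discD = discD'"
proof (intro set_eqI iffI)
  fix z assume "z \<in> discD'"
  then have "Cinv z \<in> discD"
    by (auto simp: discD_def discD'_def norm_divide)
  then show "z \<in> Cinv ` discD"
    by (metis Cinv_Cinv image_eqI)
next
  fix z assume "z \<in> Cinv ` discD"
  then obtain a where a: "norm a < 1" "z = Cinv (Pt a)"
    by (auto simp: discD_def)
  then show "z \<in> discD'"
    by (cases "a = 0") (auto simp: discD'_def norm_divide)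
qed

text \<open>
  A covector at \<open>z\<close> is represented by its coefficient in the frame \<open>d(loc_coord z)\<close> of \<open>K\<^sub>z\<close>, that is
  \<open>du\<close> for \<open>z \<noteq> Pole\<close> and \<open>dv\<close> for \<open>z = Pole\<close>.
\<close>

definition loc_coord :: "pline \<Rightarrow> pline \<Rightarrow> complex" where
  "loc_coord z = (if z = Pole then v_coord else u_coord)"

definition loc_point :: "pline \<Rightarrow> complex \<Rightarrow> pline" where
  "loc_point z = (if z = Pole then v_point else Pt)"

text \<open>
  \<open>C_pull z\<close> is the coefficient, in the frame at \<open>z\<close>, of the \<open>C\<close>-pull-back of the complex conjugate of
  the frame at \<open>C(z)\<close>; so the \<open>(0,1)\<close>-covector with coefficient \<open>c\<close> at \<open>C(z)\<close> is taken by \<open>C\<^sup>*\<close> to the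
  \<open>(1,0)\<close>-covector with coefficient \<open>C_pull z * c\<close> at \<open>z\<close>.
\<close>

definition C_pull :: "pline \<Rightarrow> complex" where
  "C_pull z = deriv (\<lambda>t. cnj (loc_coord (Cinv z) (Cinv (loc_point z t)))) (loc_coord z z)"

lemma C_pull_simps:
  "a \<noteq> 0 \<Longrightarrow> C_pull (Pt a) = - 1 / a\<^sup>2" "C_pull (Pt 0) = 1" "C_pull Pole = 1"
proof -
  assume a: "a \<noteq> 0"
  have "eventually (\<lambda>t. t \<in> - {0}) (nhds a)"
    using a by (intro eventually_nhds_in_open) auto
  then have "eventually (\<lambda>t. cnj (loc_coord (Cinv (Pt a)) (Cinv (loc_point (Pt a) t))) = 1 / t) (nhds a)"
    by eventually_elim (use a in \<open>simp add: loc_coord_def loc_point_def\<close>)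
  then have "C_pull (Pt a) = deriv (\<lambda>t. 1 / t) a"
    unfolding C_pull_def by (intro deriv_cong_ev) (auto simp: loc_coord_def)
  also have "\<dots> = - 1 / a\<^sup>2"
    using a by (intro DERIV_imp_deriv) (auto intro!: derivative_eq_intros simp: power2_eq_square)
  finally show "C_pull (Pt a) = - 1 / a\<^sup>2" .
next
  have "(\<lambda>t. cnj (v_coord (Cinv (Pt t)))) = (\<lambda>t. t)"
    by (rule ext) auto
  then show "C_pull (Pt 0) = 1"
    by (simp add: C_pull_def loc_coord_def loc_point_def)
next
  have "(\<lambda>t. cnj (u_coord (Cinv (v_point t)))) = (\<lambda>t. t)"
    by (rule ext) (auto simp: v_point_def)
  then show "C_pull Pole = 1"
    by (simp add: C_pull_def loc_coord_def loc_point_def)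
qed


section \<open>Meromorphic 1-forms\<close>

text \<open>
  The 1-form \<open>f du\<close> is represented by \<open>f\<close>, normalised to take the value \<open>0\<close> at its poles. From
  \<open>du = - dv / v\<^sup>2\<close> one gets its coefficient with respect to \<open>dv\<close>.
\<close>

definition v_coeff :: "(complex \<Rightarrow> complex) \<Rightarrow> complex \<Rightarrow> complex" where
  "v_coeff f v = - f (1 / v) / v\<^sup>2"

definition mero_form :: "(complex \<Rightarrow> complex) \<Rightarrow> bool" where
  "mero_form f \<longleftrightarrow> f nicely_meromorphic_on UNIV \<and> v_coeff f meromorphic_on {0}"

fun form_pole :: "(complex \<Rightarrow> complex) \<Rightarrow> pline \<Rightarrow> bool" where
  "form_pole f (Pt a) \<longleftrightarrow> is_pole f a"
| "form_pole f Pole \<longleftrightarrow> is_pole (v_coeff f) 0"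

fun form_residue :: "(complex \<Rightarrow> complex) \<Rightarrow> pline \<Rightarrow> complex" where
  "form_residue f (Pt a) = residue f a"
| "form_residue f Pole = residue (v_coeff f) 0"

definition D_form :: "(complex \<Rightarrow> complex) \<Rightarrow> bool" where
  "D_form f \<longleftrightarrow> mero_form f \<and> (\<forall>z. form_residue f z = 0) \<and> (\<forall>z. form_pole f z \<longrightarrow> z \<in> discD)"

text \<open>Coefficient of the value at \<open>z\<close> of the form \<open>f du\<close>, in the frame at \<open>z\<close>.\<close>

fun form_coeff :: "(complex \<Rightarrow> complex) \<Rightarrow> pline \<Rightarrow> complex" where
  "form_coeff f (Pt a) = f a"
| "form_coeff f Pole = remove_sings (v_coeff f) 0"

lemma D_form_mero: "D_form f \<Longrightarrow> f nicely_meromorphic_on UNIV"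
  by (simp add: D_form_def mero_form_def)

lemma D_form_analytic: 
  assumes "D_form f" "norm a \<ge> 1"
  shows "f analytic_on {a}"
proof -
  have "Pt a \<notin> discD" using assms by (auto simp: discD_def)
  then have "\<not> form_pole f (Pt a)" using assms by (auto simp: D_form_def)
  then show ?thesis
    using D_form_mero[OF assms(1)] nicely_meromorphic_on_imp_analytic_at[of f UNIV a] by auto
qed

lemma D_form_tendsto_Pole:
  assumes "D_form f"
  shows "v_coeff f \<midarrow>0\<rightarrow> form_coeff f Pole"
proof -
  have "\<not> is_pole (v_coeff f) 0"
    using assms by (auto simp: D_form_def discD_def dest!: spec[of _ Pole])
  moreover have "not_essential (v_coeff f) 0"
    using assms meromorphic_at_iff by (auto simp: D_form_def mero_form_def)
  ultimately obtain c where c: "v_coeff f \<midarrow>0\<rightarrow> c"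
    by (auto simp: not_essential_def)
  then show ?thesis using remove_sings_eqI[OF c] by simp
qed

text \<open>
  Zero residue at \<open>Pole\<close> is automatic for a form without a pole there.
\<close>

lemma D_formI:
  assumes "f nicely_meromorphic_on UNIV" "\<And>a. residue f a = 0" "\<And>a. is_pole f a \<Longrightarrow> norm a < 1"
    and "v_coeff f meromorphic_on {0}" "v_coeff f \<midarrow>0\<rightarrow> c"
  shows "D_form f"
proof -
  have np: "\<not> is_pole (v_coeff f) 0"
    using assms(5) by (meson at_neq_bot is_pole_def not_tendsto_and_filterlim_at_infinity)
  have "residue (v_coeff f) 0 = 0"
  proof -
    have "residue (v_coeff f) 0 = residue (remove_sings (v_coeff f)) 0"
      using assms(4) meromorphic_at_iff by (auto intro!: residue_remove_sings[symmetric])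
    moreover have "remove_sings (v_coeff f) analytic_on {0}"
      using assms(4,5) meromorphic_at_iff by (intro remove_sings_analytic_at) auto
    then obtain S where "open S" "0 \<in> S" "remove_sings (v_coeff f) holomorphic_on S"
      using analytic_at by blast
    ultimately show ?thesis using residue_holo by metis
  qed
  then have "form_residue f z = 0" for z
    using assms(2) by (cases z) auto
  moreover have "form_pole f z \<Longrightarrow> z \<in> discD" for z
    using assms(3) np by (cases z) (auto simp: discD_def)
  ultimately show ?thesis
    using assms by (auto simp: D_form_def mero_form_def)
qed

lemma D_form_zero: "D_form (\<lambda>_. 0)"
  by (rule D_formI[where c = 0]) (auto simp: v_coeff_def[abs_def] residue_const)

lemma D_form_cmult:
  assumes f: "D_form f"
  shows "D_form (\<lambda>z. c * f z)"
proof (rule D_formI[where c = "c * form_coeff f Pole"])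
  have ex: "\<exists>A. open A \<and> a \<in> A \<and> f holomorphic_on A - {a}" for a
  proof -
    have "isolated_singularity_at f a"
      using D_form_mero[OF f] meromorphic_at_iff[of f a] meromorphic_on_subset[of f UNIV "{a}"]
      by (auto simp: nicely_meromorphic_on_def)
    then show ?thesis
      by (metis analytic_imp_holomorphic centre_in_ball isolated_singularity_at_def open_ball)
  qed
  then obtain A where "\<And>a. open (A a) \<and> a \<in> A a \<and> f holomorphic_on A a - {a}"
    by metis
  then show "residue (\<lambda>z. c * f z) a = 0" for a
    using f residue_lmul[of "A a" a f c] by (auto simp: D_form_def dest!: spec[of _ "Pt a"])
  show "norm a < 1" if "is_pole (\<lambda>z. c * f z) a" for a
  proof (rule ccontr)
    assume "\<not> norm a < 1"
    then have "(\<lambda>z. c * f z) analytic_on {a}" 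
      using D_form_analytic[OF f, of a] by (intro analytic_intros) auto
    with that show False using analytic_at_imp_no_pole by blast
  qed
  have eq: "v_coeff (\<lambda>z. c * f z) = (\<lambda>v. c * v_coeff f v)"
    by (simp add: v_coeff_def fun_eq_iff)
  show "v_coeff (\<lambda>z. c * f z) meromorphic_on {0}"
    using f unfolding eq by (auto simp: D_form_def mero_form_def intro!: meromorphic_intros)
  show "v_coeff (\<lambda>z. c * f z) \<midarrow>0\<rightarrow> c * form_coeff f Pole"
    unfolding eq by (intro tendsto_intros D_form_tendsto_Pole[OF f])
qed (use D_form_mero[OF f] in auto)

lemma v_coeff_add_eventually:
  assumes "D_form f" "D_form g"
  shows "eventually (\<lambda>v. v_coeff f v + v_coeff g v = v_coeff (remove_sings (\<lambda>z. f z + g z)) v) (at 0)"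
proof -
  have "eventually (\<lambda>v::complex. v \<in> ball 0 1 - {0}) (at 0)"
    by (intro eventually_at_in_open) auto
  then show ?thesis
  proof eventually_elim
    case (elim v)
    then have "norm (1 / v) \<ge> 1" by (simp add: norm_divide)
    then have "(\<lambda>z. f z + g z) analytic_on {1 / v}"
      by (intro analytic_intros D_form_analytic assms)
    then show ?case
      by (simp add: v_coeff_def add_divide_distrib diff_divide_distrib)
  qed
qed

lemma D_form_add:
  assumes f: "D_form f" and g: "D_form g"
  shows "D_form (remove_sings (\<lambda>z. f z + g z))"
proof (rule D_formI[where c = "form_coeff f Pole + form_coeff g Pole"])
  let ?h = "\<lambda>z. f z + g z"
  have mero: "?h meromorphic_on UNIV"
    using f g D_form_mero by (auto simp: nicely_meromorphic_on_def intro!: meromorphic_intros)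
  then show "remove_sings ?h nicely_meromorphic_on UNIV"
    by (rule remove_sings_nicely_meromorphic)
  have isoh: "isolated_singularity_at ?h a" and nes: "not_essential ?h a" for a
    using mero meromorphic_at_iff[of ?h a] meromorphic_on_subset[of ?h UNIV "{a}"] by auto
  have ex: "\<exists>A. open A \<and> a \<in> A \<and> k holomorphic_on A - {a}" if "D_form k" for k a
  proof -
    have "isolated_singularity_at k a"
      using D_form_mero[OF that] meromorphic_at_iff[of k a] meromorphic_on_subset[of k UNIV "{a}"]
      by (auto simp: nicely_meromorphic_on_def)
    then show ?thesis
      by (metis analytic_imp_holomorphic centre_in_ball isolated_singularity_at_def open_ball)
  qed
  show "residue (remove_sings ?h) a = 0" for a
  proof -
    obtain A B where "open A" "a \<in> A" "f holomorphic_on A - {a}"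
      "open B" "a \<in> B" "g holomorphic_on B - {a}"
      using ex[OF f] ex[OF g] by metis
    then have "residue ?h a = residue f a + residue g a"
      by (intro residue_add[of "A \<inter> B"]) (auto intro: holomorphic_on_subset)
    then have "residue ?h a = 0"
      using f g by (auto simp: D_form_def dest!: spec[of _ "Pt a"])
    then show ?thesis
      using isoh by simp
  qed
  show "norm a < 1" if "is_pole (remove_sings ?h) a" for a
  proof (rule ccontr)
    assume "\<not> norm a < 1"
    then have "?h analytic_on {a}" 
      using D_form_analytic[OF f, of a] D_form_analytic[OF g, of a] by (intro analytic_intros) auto
    then have "remove_sings ?h analytic_on {a}"
      by (rule remove_sings_analytic_on)
    with that show False using analytic_at_imp_no_pole by blast
  qed
  have "(\<lambda>v. v_coeff f v + v_coeff g v) meromorphic_on {0}"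
    using f g by (auto simp: D_form_def mero_form_def intro!: meromorphic_intros)
  then show "v_coeff (remove_sings ?h) meromorphic_on {0}"
    using v_coeff_add_eventually[OF f g]
    by (subst meromorphic_on_cong[of "{0}" _ "\<lambda>v. v_coeff f v + v_coeff g v" "{0}"])
       (auto elim: eventually_mono)
  have "(\<lambda>v. v_coeff f v + v_coeff g v) \<midarrow>0\<rightarrow> form_coeff f Pole + form_coeff g Pole"
    by (intro tendsto_add D_form_tendsto_Pole f g)
  then show "v_coeff (remove_sings ?h) \<midarrow>0\<rightarrow> form_coeff f Pole + form_coeff g Pole"
    using v_coeff_add_eventually[OF f g] by (rule Lim_transform_eventually)
qed

typedef KD = "{f. D_form f}"
  using D_form_zero by blast

text \<open>
  The sum is the pointwise sum away from the poles; \<open>remove_sings\<close> restores the correct value at a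
  common pole.
\<close>

instantiation KD :: ab_group_add
begin

definition zero_KD :: KD where
  "0 = Abs_KD (\<lambda>_. 0)"

definition plus_KD :: "KD \<Rightarrow> KD \<Rightarrow> KD" where
  "\<alpha> + \<beta> = Abs_KD (remove_sings (\<lambda>z. Rep_KD \<alpha> z + Rep_KD \<beta> z))"

definition uminus_KD :: "KD \<Rightarrow> KD" where
  "- \<alpha> = Abs_KD (\<lambda>z. - Rep_KD \<alpha> z)"

definition minus_KD :: "KD \<Rightarrow> KD \<Rightarrow> KD" where
  "\<alpha> - \<beta> = \<alpha> + - (\<beta> :: KD)"

lemma Rep_KD_D_form: "D_form (Rep_KD \<alpha>)"
  using Rep_KD by simp

lemma Rep_KD_zero: "Rep_KD 0 = (\<lambda>_. 0)"
  by (simp add: zero_KD_def Abs_KD_inverse D_form_zero)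

lemma Rep_KD_add: "Rep_KD (\<alpha> + \<beta>) = remove_sings (\<lambda>z. Rep_KD \<alpha> z + Rep_KD \<beta> z)"
  by (simp add: plus_KD_def Abs_KD_inverse D_form_add Rep_KD_D_form)

lemma Rep_KD_uminus: "Rep_KD (- \<alpha>) = (\<lambda>z. - Rep_KD \<alpha> z)"
  using D_form_cmult[OF Rep_KD_D_form[of \<alpha>], of "-1"] by (simp add: uminus_KD_def Abs_KD_inverse)

lemma Rep_KD_isolated: "isolated_singularity_at (Rep_KD \<alpha>) z"
  using D_form_mero[OF Rep_KD_D_form[of \<alpha>]] meromorphic_at_iff[of "Rep_KD \<alpha>" z]
    meromorphic_on_subset[of "Rep_KD \<alpha>" UNIV "{z}"]
  by (auto simp: nicely_meromorphic_on_def)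

lemma Rep_KD_not_essential: "not_essential (Rep_KD \<alpha>) z"
  using D_form_mero[OF Rep_KD_D_form[of \<alpha>]] meromorphic_at_iff[of "Rep_KD \<alpha>" z]
    meromorphic_on_subset[of "Rep_KD \<alpha>" UNIV "{z}"]
  by (auto simp: nicely_meromorphic_on_def)

lemma remove_sings_Rep_KD: "remove_sings (Rep_KD \<alpha>) = Rep_KD \<alpha>"
proof
  fix z
  have "(is_pole (Rep_KD \<alpha>) z \<and> Rep_KD \<alpha> z = 0) \<or> Rep_KD \<alpha> \<midarrow>z\<rightarrow> Rep_KD \<alpha> z"
    using D_form_mero[OF Rep_KD_D_form[of \<alpha>]] by (auto simp: nicely_meromorphic_on_def)
  then show "remove_sings (Rep_KD \<alpha>) z = Rep_KD \<alpha> z"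
    by (auto intro: remove_sings_eqI)
qed

lemma Rep_KD_add_eventually:
  "eventually (\<lambda>w. Rep_KD (\<alpha> + \<beta>) w = Rep_KD \<alpha> w + Rep_KD \<beta> w) (at z)"
  unfolding Rep_KD_add
  by (intro eventually_remove_sings_eq_at singularity_intros Rep_KD_isolated)

lemma KD_eqI:
  assumes "\<And>z. eventually (\<lambda>w. Rep_KD \<alpha> w = Rep_KD \<beta> w) (at z)"
  shows "\<alpha> = \<beta>"
proof -
  have "remove_sings (Rep_KD \<alpha>) = remove_sings (Rep_KD \<beta>)"
    using assms by (intro ext remove_sings_cong) auto
  then show ?thesis by (simp add: remove_sings_Rep_KD Rep_KD_inject)
qed

instance
proof
  fix \<alpha> \<beta> \<gamma> :: KD
  show "\<alpha> + \<beta> + \<gamma> = \<alpha> + (\<beta> + \<gamma>)"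
  proof (rule KD_eqI)
    fix z
    show "eventually (\<lambda>w. Rep_KD (\<alpha> + \<beta> + \<gamma>) w = Rep_KD (\<alpha> + (\<beta> + \<gamma>)) w) (at z)"
      using Rep_KD_add_eventually[of "\<alpha> + \<beta>" \<gamma> z] Rep_KD_add_eventually[of \<alpha> \<beta> z]
        Rep_KD_add_eventually[of \<alpha> "\<beta> + \<gamma>" z] Rep_KD_add_eventually[of \<beta> \<gamma> z]
      by eventually_elim simp
  qed
  show "\<alpha> + \<beta> = \<beta> + \<alpha>"
    by (simp add: plus_KD_def add.commute)
  show "0 + \<alpha> = \<alpha>"
    by (simp add: plus_KD_def Rep_KD_zero remove_sings_Rep_KD Rep_KD_inverse)
  show "- \<alpha> + \<alpha> = 0"
  proof (rule KD_eqI)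
    fix z
    show "eventually (\<lambda>w. Rep_KD (- \<alpha> + \<alpha>) w = Rep_KD 0 w) (at z)"
      using Rep_KD_add_eventually[of "- \<alpha>" \<alpha> z]
      by eventually_elim (simp add: Rep_KD_uminus Rep_KD_zero)
  qed
  show "\<alpha> - \<beta> = \<alpha> + - \<beta>"
    by (simp add: minus_KD_def)
qed

end

definition scaleKD :: "complex \<Rightarrow> KD \<Rightarrow> KD" where
  "scaleKD c \<alpha> = Abs_KD (\<lambda>z. c * Rep_KD \<alpha> z)"

lemma Rep_KD_scale: "Rep_KD (scaleKD c \<alpha>) = (\<lambda>z. c * Rep_KD \<alpha> z)"
  by (simp add: scaleKD_def Abs_KD_inverse D_form_cmult Rep_KD_D_form)

lemma vector_space_KD: "vector_space scaleKD"
proof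
  fix a b :: complex and \<alpha> \<beta> :: KD
  show "scaleKD a (\<alpha> + \<beta>) = scaleKD a \<alpha> + scaleKD a \<beta>"
  proof (rule KD_eqI)
    fix z
    show "eventually (\<lambda>w. Rep_KD (scaleKD a (\<alpha> + \<beta>)) w = Rep_KD (scaleKD a \<alpha> + scaleKD a \<beta>) w) (at z)"
      using Rep_KD_add_eventually[of \<alpha> \<beta> z] Rep_KD_add_eventually[of "scaleKD a \<alpha>" "scaleKD a \<beta>" z]
      by eventually_elim (simp add: Rep_KD_scale algebra_simps)
  qed
  show "scaleKD (a + b) \<alpha> = scaleKD a \<alpha> + scaleKD b \<alpha>"
  proof (rule KD_eqI)
    fix z
    show "eventually (\<lambda>w. Rep_KD (scaleKD (a + b) \<alpha>) w = Rep_KD (scaleKD a \<alpha> + scaleKD b \<alpha>) w) (at z)"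
      using Rep_KD_add_eventually[of "scaleKD a \<alpha>" "scaleKD b \<alpha>" z]
      by eventually_elim (simp add: Rep_KD_scale algebra_simps)
  qed
  show "scaleKD a (scaleKD b \<alpha>) = scaleKD (a * b) \<alpha>"
    by (simp add: Rep_KD_scale mult.assoc flip: Rep_KD_inject)
  show "scaleKD 1 \<alpha> = \<alpha>"
    by (simp add: Rep_KD_scale flip: Rep_KD_inject)
qed

text \<open>Evaluation at a point outside \<open>D\<close> is a linear functional.\<close>

lemma form_coeff_add:
  assumes "z \<notin> discD"
  shows "form_coeff (Rep_KD (\<alpha> + \<beta>)) z = form_coeff (Rep_KD \<alpha>) z + form_coeff (Rep_KD \<beta>) z"
proof (cases z)
  case (Pt a)
  then have "norm a \<ge> 1" using assms by (auto simp: discD_def)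
  then have "(\<lambda>z. Rep_KD \<alpha> z + Rep_KD \<beta> z) analytic_on {a}"
    by (intro analytic_intros D_form_analytic Rep_KD_D_form)
  then show ?thesis
    by (simp add: Pt Rep_KD_add)
next
  case Pole
  have "v_coeff (Rep_KD (\<alpha> + \<beta>)) \<midarrow>0\<rightarrow> form_coeff (Rep_KD \<alpha>) Pole + form_coeff (Rep_KD \<beta>) Pole"
    unfolding Rep_KD_add
    by (rule Lim_transform_eventually[OF _ v_coeff_add_eventually])
       (intro tendsto_add D_form_tendsto_Pole Rep_KD_D_form)+
  moreover have "v_coeff (Rep_KD (\<alpha> + \<beta>)) \<midarrow>0\<rightarrow> form_coeff (Rep_KD (\<alpha> + \<beta>)) Pole"
    by (rule D_form_tendsto_Pole[OF Rep_KD_D_form])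
  ultimately show ?thesis
    using Pole LIM_unique by blast
qed

lemma form_coeff_scale:
  assumes "z \<notin> discD"
  shows "form_coeff (Rep_KD (scaleKD c \<alpha>)) z = c * form_coeff (Rep_KD \<alpha>) z"
proof (cases z)
  case Pole
  have "v_coeff (Rep_KD (scaleKD c \<alpha>)) = (\<lambda>v. c * v_coeff (Rep_KD \<alpha>) v)"
    by (simp add: Rep_KD_scale v_coeff_def fun_eq_iff)
  then have "v_coeff (Rep_KD (scaleKD c \<alpha>)) \<midarrow>0\<rightarrow> c * form_coeff (Rep_KD \<alpha>) Pole"
    by (auto intro!: tendsto_intros D_form_tendsto_Pole Rep_KD_D_form simp del: form_coeff.simps)
  moreover have "v_coeff (Rep_KD (scaleKD c \<alpha>)) \<midarrow>0\<rightarrow> form_coeff (Rep_KD (scaleKD c \<alpha>)) Pole"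
    by (rule D_form_tendsto_Pole[OF Rep_KD_D_form])
  ultimately show ?thesis
    using Pole LIM_unique by blast
qed (simp add: Rep_KD_scale)

text \<open>
  \<open>e_form n a\<close> is the coefficient of \<open>w ^ n\<close> in the Taylor expansion of \<open>- du / (u - (a + w))\<^sup>2\<close>
  in powers of \<open>w\<close>; see lemma \<open>e_form_sums\<close>. In particular \<open>e_form 0 a = - du / (u - a)\<^sup>2\<close>.
\<close>

definition e_form :: "nat \<Rightarrow> complex \<Rightarrow> KD" where
  "e_form n a = Abs_KD (\<lambda>u. - of_nat (Suc n) / (u - a) ^ (n + 2))"

lemma D_form_e:
  assumes "norm a < 1"
  shows "D_form (\<lambda>u. - of_nat (Suc n) / (u - a) ^ (n + 2))" (is "D_form ?f")
proof -
  have mero: "?f meromorphic_on UNIV"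
    by (intro meromorphic_intros)
  have ana: "?f analytic_on {z}" if "z \<noteq> a" for z
    using that by (intro analytic_intros) auto
  have lim: "((\<lambda>v. of_nat (Suc n) * v ^ n / (1 - a * v) ^ (n + 2)) \<longlongrightarrow>
               of_nat (Suc n) * 0 ^ n / (1 - a * 0) ^ (n + 2)) (at 0)"
    by (intro tendsto_intros) auto
  have ev: "eventually (\<lambda>v. of_nat (Suc n) * v ^ n / (1 - a * v) ^ (n + 2) = v_coeff ?f v) (at 0)"
  proof -
    have "eventually (\<lambda>v::complex. v \<in> ball 0 1 - {0}) (at 0)"
      by (intro eventually_at_in_open) auto
    then show ?thesis
    proof eventually_elim
      case (elim v)
      have "(1 / v - a) = (1 - a * v) / v"
        using elim by (simp add: field_simps)
      then show ?case using elim
        by (simp add: v_coeff_def power_divide power_add power2_eq_square flip: minus_divide_left of_nat_Suc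
            del: of_nat_Suc)
    qed
  qed
  have "?f nicely_meromorphic_on UNIV"
    unfolding nicely_meromorphic_on_def
  proof (intro conjI ballI mero)
    fix z
    show "is_pole ?f z \<and> ?f z = 0 \<or> ?f \<midarrow>z\<rightarrow> ?f z"
    proof (cases "z = a")
      case True
      have "is_pole (\<lambda>u. - of_nat (Suc n) * (1 / (u - a) ^ (n + 2))) a"
        by (subst is_pole_cmult_iff) (auto intro: is_pole_inverse_power simp del: of_nat_Suc power_Suc add_2_eq_Suc' simp flip: of_nat_Suc)
      then show ?thesis using True by simp
    next
      case False
      then show ?thesis
        using ana[OF False] analytic_at_imp_isCont isContD by blast
    qed
  qed
  moreover have "residue ?f z = 0" for z
  proof (cases "z = a")
    case True
    have "residue (\<lambda>w. (- of_nat (Suc n)) / (w - a) ^ Suc (Suc n)) a =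
          (deriv ^^ Suc n) (\<lambda>_. - of_nat (Suc n)) a / fact (Suc n)"
      by (rule residue_holomorphic_over_power[of UNIV]) auto
    also have "\<dots> = 0"
      by (simp add: higher_deriv_const del: funpow.simps)
    finally show ?thesis using True by simp
  next
    case False
    from ana[OF False] show ?thesis
      by (meson analytic_at residue_holo)
  qed
  moreover have "norm z < 1" if "is_pole ?f z" for z
    using that ana[of z] assms analytic_at_imp_no_pole by blast
  moreover have "v_coeff ?f meromorphic_on {0}"
    unfolding v_coeff_def by (intro meromorphic_intros)
  ultimately show ?thesis
    using Lim_transform_eventually[OF lim ev] by (rule D_formI)
qed

lemma Rep_e_form:
  "norm a < 1 \<Longrightarrow> Rep_KD (e_form n a) = (\<lambda>u. - of_nat (Suc n) / (u - a) ^ (n + 2))"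
  unfolding e_form_def by (rule Abs_KD_inverse) (use D_form_e in auto)

lemma e_form_sums:
  assumes "norm a < 1" "norm (a + w) < 1" "norm w < norm (x - a)"
  shows "(\<lambda>n. Rep_KD (e_form n a) x * w ^ n) sums Rep_KD (e_form 0 (a + w)) x"
proof -
  have x: "x - a \<noteq> 0" using assms(3) by auto
  have "norm (w / (x - a)) < 1"
    using assms(3) x by (simp add: norm_divide)
  then have "(\<lambda>n. of_nat (Suc n) * (w / (x - a)) ^ n) sums (1 / (1 - w / (x - a))\<^sup>2)"
    by (rule geometric_deriv_sums)
  then have "(\<lambda>n. (- 1 / (x - a)\<^sup>2) * (of_nat (Suc n) * (w / (x - a)) ^ n)) sums
               ((- 1 / (x - a)\<^sup>2) * (1 / (1 - w / (x - a))\<^sup>2))"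
    by (rule sums_mult)
  also have "(\<lambda>n. (- 1 / (x - a)\<^sup>2) * (of_nat (Suc n) * (w / (x - a)) ^ n)) =
             (\<lambda>n. Rep_KD (e_form n a) x * w ^ n)"
    using assms(1) x
    by (simp add: Rep_e_form power_divide power_add power2_eq_square fun_eq_iff mult_ac
        del: of_nat_Suc)
  also have "(- 1 / (x - a)\<^sup>2) * (1 / (1 - w / (x - a))\<^sup>2) = Rep_KD (e_form 0 (a + w)) x"
  proof -
    have "1 - w / (x - a) = (x - (a + w)) / (x - a)"
      using x by (simp add: field_simps)
    then show ?thesis
      using assms(2) x by (simp add: Rep_e_form power_divide power2_eq_square)
  qed
  finally show ?thesis .
qed


section \<open>The symmetric algebra\<close>

text \<open>
  The symmetric algebra of \<open>KD\<close> is the free commutative algebra on the set \<open>KD\<close> (polynomials in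
  variables indexed by \<open>KD\<close>) modulo the ideal that makes the variables depend linearly on the
  index. Ideals are submodules, hence \<open>module.span (*)\<close>.
\<close>

type_synonym free_alg = "(KD \<Rightarrow>\<^sub>0 nat) \<Rightarrow>\<^sub>0 complex"

definition free_const :: "complex \<Rightarrow> free_alg" where
  "free_const c = Poly_Mapping.single 0 c"

definition free_var :: "KD \<Rightarrow> free_alg" where
  "free_var \<alpha> = Poly_Mapping.single (Poly_Mapping.single \<alpha> 1) 1"

definition sym_ideal :: "free_alg set" where
  "sym_ideal = module.span (*)
     ({free_var (\<alpha> + \<beta>) - free_var \<alpha> - free_var \<beta> |\<alpha> \<beta>. True} \<union>
      {free_var (scaleKD c \<alpha>) - free_const c * free_var \<alpha> |c \<alpha>. True})"

definition sym_rel :: "free_alg \<Rightarrow> free_alg \<Rightarrow> bool" where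
  "sym_rel p q \<longleftrightarrow> p - q \<in> sym_ideal"

lemma module_mult: "module ((*) :: 'a \<Rightarrow> 'a \<Rightarrow> 'a::comm_ring_1)"
  by unfold_locales (auto simp: algebra_simps)

lemma sym_ideal_0: "0 \<in> sym_ideal"
  and sym_ideal_add: "p \<in> sym_ideal \<Longrightarrow> q \<in> sym_ideal \<Longrightarrow> p + q \<in> sym_ideal"
  and sym_ideal_mult: "p \<in> sym_ideal \<Longrightarrow> r * p \<in> sym_ideal"
  and sym_ideal_uminus: "p \<in> sym_ideal \<Longrightarrow> - p \<in> sym_ideal"
  unfolding sym_ideal_def
  by (auto intro: module.span_zero[OF module_mult] module.span_add[OF module_mult]
      module.span_scale[OF module_mult] module.span_neg[OF module_mult])

lemma sym_ideal_diff: "p \<in> sym_ideal \<Longrightarrow> q \<in> sym_ideal \<Longrightarrow> p - q \<in> sym_ideal"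
  using sym_ideal_add[OF _ sym_ideal_uminus[of q], of p] by simp

lemma sym_ideal_induct [consumes 1, case_names zero add mult var_add var_scale]:
  assumes "p \<in> sym_ideal"
    and "P 0" "\<And>p q. P p \<Longrightarrow> P q \<Longrightarrow> P (p + q)" "\<And>p r. P p \<Longrightarrow> P (r * p)"
    and "\<And>\<alpha> \<beta>. P (free_var (\<alpha> + \<beta>) - free_var \<alpha> - free_var \<beta>)"
    and "\<And>c \<alpha>. P (free_var (scaleKD c \<alpha>) - free_const c * free_var \<alpha>)"
  shows "P p"
proof -
  have "module.subspace (*) (Collect P)"
    using assms(2-4) by (auto simp: module.subspace_def[OF module_mult])
  from module.span_induct[OF module_mult assms(1)[unfolded sym_ideal_def] this] show ?thesis
    using assms(5,6) by auto
qed

lemma sym_rel_equivp: "equivp sym_rel"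
proof (rule equivpI)
  show "reflp sym_rel"
    by (auto simp: reflp_def sym_rel_def sym_ideal_0)
  show "symp sym_rel"
    using sym_ideal_uminus by (force simp: symp_def sym_rel_def)
  show "transp sym_rel"
    using sym_ideal_add by (force simp: transp_def sym_rel_def)
qed

quotient_type WD = free_alg / sym_rel
  by (rule sym_rel_equivp)

lemma lookup_mult_zero: "Poly_Mapping.lookup (p * q) 0 = Poly_Mapping.lookup p 0 * Poly_Mapping.lookup q (0 :: KD \<Rightarrow>\<^sub>0 nat)"
  for p q :: free_alg
proof -
  have zero: "(0 = k + l) \<longleftrightarrow> k = 0 \<and> l = 0" for k l :: "KD \<Rightarrow>\<^sub>0 nat"
    by (auto simp: poly_mapping_eq_iff lookup_add fun_eq_iff)
  have "(\<Sum>l. Poly_Mapping.lookup q l when 0 = k + l) = (Poly_Mapping.lookup q 0 when k = 0)" for k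
    by (cases "k = 0") (auto simp: zero)
  then show ?thesis
    by (simp add: lookup_mult mult_when)
qed

instantiation WD :: comm_ring_1
begin

lift_definition zero_WD :: WD is 0 .

lift_definition one_WD :: WD is 1 .

lift_definition plus_WD :: "WD \<Rightarrow> WD \<Rightarrow> WD" is "(+)"
  unfolding sym_rel_def by (metis add_diff_add sym_ideal_add)

lift_definition uminus_WD :: "WD \<Rightarrow> WD" is "uminus"
  unfolding sym_rel_def by (metis minus_diff_minus sym_ideal_uminus)

lift_definition minus_WD :: "WD \<Rightarrow> WD \<Rightarrow> WD" is "(-)"
proof -
  fix p p' q q' :: free_alg
  assume "sym_rel p p'" "sym_rel q q'"
  then have "(p - p') - (q - q') \<in> sym_ideal"
    unfolding sym_rel_def by (rule sym_ideal_diff)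
  then show "sym_rel (p - q) (p' - q')"
    by (simp add: sym_rel_def algebra_simps)
qed

lift_definition times_WD :: "WD \<Rightarrow> WD \<Rightarrow> WD" is "(*)"
proof -
  fix p p' q q' :: free_alg
  assume "sym_rel p p'" "sym_rel q q'"
  then have "q * (p - p') + p' * (q - q') \<in> sym_ideal"
    unfolding sym_rel_def by (intro sym_ideal_add sym_ideal_mult)
  then show "sym_rel (p * q) (p' * q')"
    by (simp add: sym_rel_def algebra_simps)
qed

lemma sym_rel_eqI: "p = q \<Longrightarrow> sym_rel p q"
  by (simp add: sym_rel_def sym_ideal_0)

instance
proof
  show "(0::WD) \<noteq> 1"
  proof transfer
    have "Poly_Mapping.lookup p 0 = 0" if "p \<in> sym_ideal" for p
      using that
      by (induction rule: sym_ideal_induct)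
         (auto simp: lookup_add lookup_minus lookup_mult_zero free_var_def lookup_single when_def
           poly_mapping_eq_iff fun_eq_iff)
    then have "(1::free_alg) \<notin> sym_ideal" by force
    then show "\<not> sym_rel 0 1"
      using sym_ideal_uminus by (force simp: sym_rel_def)
  qed
  fix x y z :: WD
  show "x * y * z = x * (y * z)" by transfer (rule sym_rel_eqI, rule mult.assoc)
  show "x * y = y * x" by transfer (rule sym_rel_eqI, rule mult.commute)
  show "1 * x = x" by transfer (rule sym_rel_eqI, rule mult_1_left)
  show "x + y + z = x + (y + z)" by transfer (rule sym_rel_eqI, rule add.assoc)
  show "x + y = y + x" by transfer (rule sym_rel_eqI, rule add.commute)
  show "0 + x = x" by transfer (rule sym_rel_eqI, rule add_0_left)
  show "- x + x = 0" by transfer (rule sym_rel_eqI, rule left_minus)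
  show "x - y = x + - y" by transfer (rule sym_rel_eqI, rule diff_conv_add_uminus)
  show "(x + y) * z = x * z + y * z" by transfer (rule sym_rel_eqI, rule distrib_right)
qed

end

lift_definition constW :: "complex \<Rightarrow> WD" is free_const .

lift_definition inclW :: "KD \<Rightarrow> WD" is free_var .

definition scaleW :: "complex \<Rightarrow> WD \<Rightarrow> WD" where
  "scaleW c \<phi> = constW c * \<phi>"

lemma constW_simps: "constW (c + d) = constW c + constW d" "constW (c * d) = constW c * constW d"
  "constW 0 = 0" "constW 1 = 1"
  by (transfer; rule sym_rel_eqI; simp add: free_const_def single_add mult_single)+

lemma vector_space_WD: "vector_space scaleW"
  by unfold_locales (simp_all add: scaleW_def constW_simps algebra_simps)

lemma inclW_add: "inclW (\<alpha> + \<beta>) = inclW \<alpha> + inclW \<beta>"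
proof (transfer, unfold sym_rel_def)
  fix \<alpha> \<beta>
  have "free_var (\<alpha> + \<beta>) - free_var \<alpha> - free_var \<beta> \<in> sym_ideal"
    unfolding sym_ideal_def by (intro module.span_base[OF module_mult]) auto
  then show "free_var (\<alpha> + \<beta>) - (free_var \<alpha> + free_var \<beta>) \<in> sym_ideal"
    by (simp add: diff_diff_eq)
qed

lemma inclW_scale: "inclW (scaleKD c \<alpha>) = scaleW c (inclW \<alpha>)"
proof (unfold scaleW_def, transfer, unfold sym_rel_def)
  fix c \<alpha>
  show "free_var (scaleKD c \<alpha>) - free_const c * free_var \<alpha> \<in> sym_ideal"
    unfolding sym_ideal_def by (intro module.span_base[OF module_mult]) auto
qed


subsection \<open>Derivations\<close>

definition derivation :: "(WD \<Rightarrow> WD) \<Rightarrow> bool" where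
  "derivation \<delta> \<longleftrightarrow> Vector_Spaces.linear scaleW scaleW \<delta> \<and>
     (\<forall>\<phi> \<psi>. \<delta> (\<phi> * \<psi>) = \<delta> \<phi> * \<psi> + \<phi> * \<delta> \<psi>)"

lemma derivationD:
  assumes "derivation \<delta>"
  shows "\<delta> (\<phi> + \<psi>) = \<delta> \<phi> + \<delta> \<psi>" "\<delta> (scaleW c \<phi>) = scaleW c (\<delta> \<phi>)"
    "\<delta> (\<phi> * \<psi>) = \<delta> \<phi> * \<psi> + \<phi> * \<delta> \<psi>" "\<delta> 1 = 0" "\<delta> 0 = 0"
proof -
  have lin: "Vector_Spaces.linear scaleW scaleW \<delta>"
    using assms by (simp add: derivation_def)
  show "\<delta> (\<phi> + \<psi>) = \<delta> \<phi> + \<delta> \<psi>" "\<delta> (scaleW c \<phi>) = scaleW c (\<delta> \<phi>)" "\<delta> 0 = 0"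
    using lin vector_space_pair.linear_add[of scaleW scaleW \<delta>]
      vector_space_pair.linear_scale[of scaleW scaleW \<delta>]
      vector_space_pair.linear_0[of scaleW scaleW \<delta>] vector_space_WD
    by (auto simp: vector_space_pair_def)
  show *: "\<delta> (\<phi> * \<psi>) = \<delta> \<phi> * \<psi> + \<phi> * \<delta> \<psi>" for \<phi> \<psi>
    using assms by (simp add: derivation_def)
  from *[of 1 1] show "\<delta> 1 = 0" by simp
qed

lemma free_alg_induct [case_names 1 2]:
  fixes p :: free_alg
  assumes "P 0" "\<And>p c m. P p \<Longrightarrow> P (Poly_Mapping.single m c + p)"
  shows "P p"
proof (induction p rule: update_induct)
  case const
  show ?case by (rule assms(1))
next
  case (update f a b)
  have "Poly_Mapping.update a b f = Poly_Mapping.single a b + f"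
    using update(1) by (intro poly_mapping_eqI) (auto simp: lookup_update lookup_add lookup_single
        when_def in_keys_iff)
  then show ?case using assms(2) update by simp
qed

lemma WD_induct [case_names one incl_mult add scale]:
  assumes "P 1" "\<And>\<alpha> \<phi>. P \<phi> \<Longrightarrow> P (inclW \<alpha> * \<phi>)" "\<And>\<phi> \<psi>. P \<phi> \<Longrightarrow> P \<psi> \<Longrightarrow> P (\<phi> + \<psi>)"
    "\<And>c \<phi>. P \<phi> \<Longrightarrow> P (scaleW c \<phi>)"
  shows "P \<phi>"
proof -
  have mono: "P (abs_WD (Poly_Mapping.single m 1))" for m
  proof (induction "\<Sum>\<alpha>\<in>Poly_Mapping.keys m. Poly_Mapping.lookup m \<alpha>" arbitrary: m)
    case 0
    then have "m = 0"
      by (auto simp: poly_mapping_eq_iff fun_eq_iff in_keys_iff)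
    then show ?case using assms(1) by (simp add: one_WD.abs_eq)
  next
    case (Suc n)
    then obtain \<alpha> where \<alpha>: "\<alpha> \<in> Poly_Mapping.keys m"
      by (metis all_not_in_conv sum.empty nat.distinct(1))
    define m' where "m' = m - Poly_Mapping.single \<alpha> 1"
    have m: "m = Poly_Mapping.single \<alpha> 1 + m'"
      using \<alpha> by (auto simp: m'_def poly_mapping_eq_iff lookup_add lookup_minus lookup_single when_def
          fun_eq_iff in_keys_iff)
    have "(\<Sum>\<beta>\<in>Poly_Mapping.keys m'. Poly_Mapping.lookup m' \<beta>) =
          (\<Sum>\<beta>\<in>Poly_Mapping.keys m. Poly_Mapping.lookup m' \<beta>)"
      by (rule sum.mono_neutral_left)
         (auto simp: m'_def lookup_minus in_keys_iff)
    also have "\<dots> = n"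
    proof -
      have "(\<Sum>\<beta>\<in>Poly_Mapping.keys m. Poly_Mapping.lookup m \<beta>) =
            (\<Sum>\<beta>\<in>Poly_Mapping.keys m. Poly_Mapping.lookup (Poly_Mapping.single \<alpha> (1::nat)) \<beta>) +
            (\<Sum>\<beta>\<in>Poly_Mapping.keys m. Poly_Mapping.lookup m' \<beta>)"
        unfolding sum.distrib[symmetric] lookup_add[symmetric] m[symmetric] by (rule refl)
      also have "(\<Sum>\<beta>\<in>Poly_Mapping.keys m. Poly_Mapping.lookup (Poly_Mapping.single \<alpha> (1::nat)) \<beta>) = 1"
        using \<alpha> by (simp add: lookup_single when_def)
      finally show ?thesis using Suc(2) by simp
    qed
    finally have "P (abs_WD (Poly_Mapping.single m' 1))"
      using Suc(1) by metis
    then have "P (inclW \<alpha> * abs_WD (Poly_Mapping.single m' 1))"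
      by (rule assms(2))
    then show ?case
      by (simp add: m inclW.abs_eq times_WD.abs_eq free_var_def mult_single)
  qed
  have "P (abs_WD p)" for p
  proof (induction p rule: free_alg_induct)
    case 1
    have "P (scaleW 0 1)" using assms(1,4) by blast
    then show ?case by (simp add: scaleW_def constW_simps zero_WD_def)
  next
    case (2 p c k)
    have "P (scaleW c (abs_WD (Poly_Mapping.single k 1)))"
      by (intro assms(4) mono)
    then have "P (abs_WD (Poly_Mapping.single k c))"
      by (simp add: scaleW_def constW.abs_eq times_WD.abs_eq free_const_def mult_single)
    then have "P (abs_WD (Poly_Mapping.single k c) + abs_WD p)"
      using 2 by (intro assms(3)) auto
    then show ?case by (simp add: plus_WD.abs_eq)
  qed
  then show ?thesis
    by (metis Quotient3_WD Quotient3_abs_rep)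
qed

lemma derivation_unique:
  assumes "derivation \<delta>" "derivation \<delta>'" "\<And>\<alpha>. \<delta> (inclW \<alpha>) = \<delta>' (inclW \<alpha>)"
  shows "\<delta> = \<delta>'"
proof
  fix \<phi>
  show "\<delta> \<phi> = \<delta>' \<phi>"
    by (induction \<phi> rule: WD_induct)
       (simp_all add: derivationD[OF assms(1)] derivationD[OF assms(2)] assms(3))
qed

text \<open>Every linear functional on \<open>KD\<close> extends to a derivation of the symmetric algebra.\<close>

definition free_mono_deriv :: "(KD \<Rightarrow> complex) \<Rightarrow> (KD \<Rightarrow>\<^sub>0 nat) \<Rightarrow> free_alg" where
  "free_mono_deriv g m = (\<Sum>\<alpha>\<in>Poly_Mapping.keys m.
     Poly_Mapping.single (m - Poly_Mapping.single \<alpha> 1) (of_nat (Poly_Mapping.lookup m \<alpha>) * g \<alpha>))"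

definition free_deriv :: "(KD \<Rightarrow> complex) \<Rightarrow> free_alg \<Rightarrow> free_alg" where
  "free_deriv g p = (\<Sum>m\<in>Poly_Mapping.keys p. free_const (Poly_Mapping.lookup p m) * free_mono_deriv g m)"

lemma free_const_simps: "free_const 0 = 0" "free_const (c + d) = free_const c + free_const d"
  "free_const (c * d) = free_const c * free_const d" "free_const 1 = 1"
  by (simp_all add: free_const_def single_add mult_single)

lemma free_deriv_superset:
  assumes "finite S" "Poly_Mapping.keys p \<subseteq> S"
  shows "free_deriv g p = (\<Sum>m\<in>S. free_const (Poly_Mapping.lookup p m) * free_mono_deriv g m)"
  unfolding free_deriv_def
  by (rule sum.mono_neutral_left) (use assms in \<open>auto simp: in_keys_iff free_const_simps\<close>)

lemma free_deriv_add: "free_deriv g (p + q) = free_deriv g p + free_deriv g q"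
proof -
  let ?S = "Poly_Mapping.keys p \<union> Poly_Mapping.keys q"
  have "Poly_Mapping.keys (p + q) \<subseteq> ?S" by (rule keys_add)
  then show ?thesis
    by (simp add: free_deriv_superset[of ?S] lookup_add free_const_simps sum.distrib ring_distribs)
qed

lemma free_deriv_single: "free_deriv g (Poly_Mapping.single m c) = free_const c * free_mono_deriv g m"
  by (subst free_deriv_superset[of "{m}"]) auto

lemma free_mono_deriv_superset:
  assumes "finite S" "Poly_Mapping.keys m \<subseteq> S"
  shows "free_mono_deriv g m = (\<Sum>\<alpha>\<in>S.
     Poly_Mapping.single (m - Poly_Mapping.single \<alpha> 1) (of_nat (Poly_Mapping.lookup m \<alpha>) * g \<alpha>))"
  unfolding free_mono_deriv_def
  by (rule sum.mono_neutral_left) (use assms in \<open>auto simp: in_keys_iff\<close>)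

lemma free_mono_deriv_add:
  "free_mono_deriv g (m + n) =
     Poly_Mapping.single m 1 * free_mono_deriv g n + free_mono_deriv g m * Poly_Mapping.single n 1"
proof -
  let ?S = "Poly_Mapping.keys m \<union> Poly_Mapping.keys n"
  have *: "Poly_Mapping.single (k + l - Poly_Mapping.single \<alpha> 1) (of_nat (Poly_Mapping.lookup l \<alpha>) * c) =
           Poly_Mapping.single k 1 *
             Poly_Mapping.single (l - Poly_Mapping.single \<alpha> 1) (of_nat (Poly_Mapping.lookup l \<alpha>) * c)"
    for k l :: "KD \<Rightarrow>\<^sub>0 nat" and \<alpha> and c :: complex
  proof (cases "Poly_Mapping.lookup l \<alpha> = 0")
    case False
    then have "k + l - Poly_Mapping.single \<alpha> 1 = k + (l - Poly_Mapping.single \<alpha> 1)"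
      by (auto simp: poly_mapping_eq_iff lookup_add lookup_minus lookup_single when_def fun_eq_iff)
    then show ?thesis by (simp add: mult_single)
  qed auto
  have "free_mono_deriv g (m + n) = (\<Sum>\<alpha>\<in>?S.
     Poly_Mapping.single (m + n - Poly_Mapping.single \<alpha> 1) (of_nat (Poly_Mapping.lookup n \<alpha>) * g \<alpha>) +
     Poly_Mapping.single (n + m - Poly_Mapping.single \<alpha> 1) (of_nat (Poly_Mapping.lookup m \<alpha>) * g \<alpha>))"
    by (subst free_mono_deriv_superset[of ?S])
       (auto simp: keys_add lookup_add ring_distribs add.commute simp flip: single_add)
  then show ?thesis
    unfolding * by (simp add: free_mono_deriv_superset[of ?S] sum.distrib sum_distrib_left
        sum_distrib_right mult.commute)
qed

lemma free_deriv_mult: "free_deriv g (p * q) = free_deriv g p * q + p * free_deriv g q"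
proof (induction p rule: free_alg_induct)
  case 1
  show ?case by (simp add: free_deriv_def)
next
  case (2 p c m)
  have single: "Poly_Mapping.single k b = free_const b * Poly_Mapping.single k 1" for k b
    by (simp add: free_const_def mult_single)
  have "free_deriv g (Poly_Mapping.single m c * q) =
        free_deriv g (Poly_Mapping.single m c) * q + Poly_Mapping.single m c * free_deriv g q"
  proof (induction q rule: free_alg_induct)
    case 1
    show ?case by (simp add: free_deriv_def)
  next
    case (2 q d n)
    have "free_deriv g (Poly_Mapping.single m c * Poly_Mapping.single n d) =
        free_deriv g (Poly_Mapping.single m c) * Poly_Mapping.single n d +
        Poly_Mapping.single m c * free_deriv g (Poly_Mapping.single n d)"
      unfolding mult_single free_deriv_single free_mono_deriv_add
      by (subst single[of n d], subst single[of m c]) (simp add: free_const_simps ring_distribs mult_ac)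
    with 2 show ?case by (simp add: ring_distribs free_deriv_add)
  qed
  with 2 show ?case by (simp add: ring_distribs free_deriv_add)
qed

lemma free_deriv_var: "free_deriv g (free_var \<alpha>) = free_const (g \<alpha>)"
  by (simp add: free_var_def free_deriv_single free_const_simps free_mono_deriv_def)
     (simp add: free_const_def)

lemma free_deriv_const: "free_deriv g (free_const c) = 0"
  by (simp add: free_const_def free_deriv_single free_mono_deriv_def)

lemma free_deriv_uminus: "free_deriv g (- p) = - free_deriv g p"
  using free_deriv_add[of g p "- p"] by (simp add: free_deriv_def eq_neg_iff_add_eq_0 add.commute)

lemma free_deriv_diff: "free_deriv g (p - q) = free_deriv g p - free_deriv g q"
  using free_deriv_add[of g p "- q"] by (simp add: free_deriv_uminus)

lemma free_deriv_sym_ideal: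
  assumes "Vector_Spaces.linear scaleKD (*) g" "p \<in> sym_ideal"
  shows "free_deriv g p \<in> sym_ideal"
proof -
  have g: "g (\<alpha> + \<beta>) = g \<alpha> + g \<beta>" "g (scaleKD c \<alpha>) = c * g \<alpha>" for \<alpha> \<beta> c
    using assms(1) by (auto simp: linear_iff_module_hom module_hom.add module_hom.scale)
  from assms(2) have "p \<in> sym_ideal \<and> free_deriv g p \<in> sym_ideal"
  proof (induction rule: sym_ideal_induct)
    case zero
    then show ?case by (simp add: sym_ideal_0 free_deriv_def)
  next
    case (add p q)
    then show ?case by (simp add: sym_ideal_add free_deriv_add)
  next
    case (mult p r)
    then show ?case
      by (simp add: free_deriv_mult sym_ideal_add sym_ideal_mult)
  next
    case (var_add \<alpha> \<beta>)
    have "free_var (\<alpha> + \<beta>) - free_var \<alpha> - free_var \<beta> \<in> sym_ideal"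
      unfolding sym_ideal_def by (intro module.span_base[OF module_mult]) auto
    then show ?case
      by (simp add: free_deriv_diff free_deriv_var g free_const_simps sym_ideal_0)
  next
    case (var_scale c \<alpha>)
    have "free_var (scaleKD c \<alpha>) - free_const c * free_var \<alpha> \<in> sym_ideal"
      unfolding sym_ideal_def by (intro module.span_base[OF module_mult]) auto
    then show ?case
      by (simp add: free_deriv_diff free_deriv_mult free_deriv_var free_deriv_const g
          free_const_simps sym_ideal_0)
  qed
  then show ?thesis by simp
qed

lemma derivation_exists:
  assumes "Vector_Spaces.linear scaleKD (*) g"
  shows "\<exists>\<delta>. derivation \<delta> \<and> (\<forall>\<alpha>. \<delta> (inclW \<alpha>) = scaleW (g \<alpha>) 1)"
proof -
  have resp: "sym_rel (free_deriv g p) (free_deriv g q)" if "sym_rel p q" for p q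
    using free_deriv_sym_ideal[OF assms, of "p - q"] that by (simp add: sym_rel_def free_deriv_diff)
  define \<delta> where "\<delta> \<phi> = abs_WD (free_deriv g (rep_WD \<phi>))" for \<phi>
  have \<delta>: "\<delta> (abs_WD p) = abs_WD (free_deriv g p)" for p
  proof -
    have "sym_rel (rep_WD (abs_WD p)) p"
      using Quotient3_WD sym_rel_equivp by (metis Quotient3_rep_abs equivp_reflp)
    then show ?thesis
      unfolding \<delta>_def using resp Quotient3_rel_abs[OF Quotient3_WD] by blast
  qed
  have surj: "\<exists>p. \<phi> = abs_WD p" for \<phi>
    by (metis Quotient3_WD Quotient3_abs_rep)
  have leib: "\<delta> (\<phi> * \<psi>) = \<delta> \<phi> * \<psi> + \<phi> * \<delta> \<psi>" and add: "\<delta> (\<phi> + \<psi>) = \<delta> \<phi> + \<delta> \<psi>" for \<phi> \<psi>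
    using surj[of \<phi>] surj[of \<psi>]
    by (auto simp: times_WD.abs_eq plus_WD.abs_eq \<delta> free_deriv_mult free_deriv_add)
  have const: "\<delta> (constW c) = 0" for c
    by (simp add: constW.abs_eq \<delta> free_deriv_const zero_WD_def)
  have "Vector_Spaces.linear scaleW scaleW \<delta>"
    unfolding Vector_Spaces.linear_iff using vector_space_WD
    by (auto simp: vector_space_pair_def add leib const scaleW_def)
  moreover have "\<delta> (inclW \<alpha>) = scaleW (g \<alpha>) 1" for \<alpha>
    by (simp add: inclW.abs_eq \<delta> free_deriv_var scaleW_def constW.abs_eq)
  ultimately show ?thesis
    using leib by (auto simp: derivation_def)
qed


section \<open>The operators and the adjointness conditions\<close>

text \<open>
  \<open>e_op n a\<close> is the coefficient of \<open>w ^ n\<close> in the expansion of the operator with which \<open>e\<close> acts at the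
  point \<open>u = a + w\<close>, so that \<open>e_hat\<close> is its case \<open>n = 0\<close>.
\<close>

definition e_op :: "nat \<Rightarrow> complex \<Rightarrow> WD \<Rightarrow> WD" where
  "e_op n a \<psi> = inclW (e_form n a) * \<psi>"

definition e_hat :: "pline \<Rightarrow> WD \<Rightarrow> WD" where
  "e_hat z = e_op 0 (u_coord z)"

text \<open>
  The coefficient of \<open>i(z)\<close> in the frame at \<open>z\<close>, which is \<open>du\<close> unless \<open>z = Pole\<close>. Meaningful only for
  \<open>z\<close> outside \<open>D\<close>, where lemma \<open>i_op_derivation\<close> applies.
\<close>

definition i_op :: "pline \<Rightarrow> WD \<Rightarrow> WD" where
  "i_op z = (THE \<delta>. derivation \<delta> \<and> \<delta> 1 = 0 \<and>
     (\<forall>\<alpha>. \<delta> (inclW \<alpha>) = scaleW (- form_coeff (Rep_KD \<alpha>) z) 1))"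

lemma i_op_derivation:
  assumes "z \<notin> discD"
  shows "derivation (i_op z)" "i_op z 1 = 0"
    "i_op z (inclW \<alpha>) = scaleW (- form_coeff (Rep_KD \<alpha>) z) 1"
proof -
  let ?P = "\<lambda>\<delta>. derivation \<delta> \<and> \<delta> 1 = 0 \<and> (\<forall>\<alpha>. \<delta> (inclW \<alpha>) = scaleW (- form_coeff (Rep_KD \<alpha>) z) 1)"
  have "Vector_Spaces.linear scaleKD (*) (\<lambda>\<alpha>. - form_coeff (Rep_KD \<alpha>) z)"
    unfolding Vector_Spaces.linear_iff
  proof (intro conjI allI)
    show "vector_space scaleKD" by (rule vector_space_KD)
    show "vector_space ((*) :: complex \<Rightarrow> complex \<Rightarrow> complex)"
      by unfold_locales (simp_all add: algebra_simps)
  next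
    fix \<alpha> \<beta> c
    show "- form_coeff (Rep_KD (\<alpha> + \<beta>)) z = - form_coeff (Rep_KD \<alpha>) z + - form_coeff (Rep_KD \<beta>) z"
      by (simp only: form_coeff_add[OF assms] minus_add_distrib)
    show "- form_coeff (Rep_KD (scaleKD c \<alpha>)) z = c * - form_coeff (Rep_KD \<alpha>) z"
      by (simp only: form_coeff_scale[OF assms] mult_minus_right)
  qed
  from derivation_exists[OF this] obtain \<delta> where \<delta>: "?P \<delta>"
    using derivationD(4) by blast
  moreover have "\<delta>' = \<delta>" if "?P \<delta>'" for \<delta>'
    using that \<delta> by (intro derivation_unique) auto
  ultimately have "?P (i_op z)"
    unfolding i_op_def by (rule theI)
  then show "derivation (i_op z)" "i_op z 1 = 0"
    "i_op z (inclW \<alpha>) = scaleW (- form_coeff (Rep_KD \<alpha>) z) 1"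
    by auto
qed

text \<open>Positivity is not part of the notion of a hermitian structure.\<close>

definition hermitian_structure :: "(WD \<Rightarrow> WD \<Rightarrow> complex) \<Rightarrow> bool" where
  "hermitian_structure B \<longleftrightarrow>
     (\<forall>\<phi> \<psi>1 \<psi>2. B \<phi> (\<psi>1 + \<psi>2) = B \<phi> \<psi>1 + B \<phi> \<psi>2) \<and>
     (\<forall>\<phi> c \<psi>. B \<phi> (scaleW c \<psi>) = c * B \<phi> \<psi>) \<and>
     (\<forall>\<phi>1 \<phi>2 \<psi>. B (\<phi>1 + \<phi>2) \<psi> = B \<phi>1 \<psi> + B \<phi>2 \<psi>) \<and>
     (\<forall>c \<phi> \<psi>. B (scaleW c \<phi>) \<psi> = cnj c * B \<phi> \<psi>) \<and>
     (\<forall>\<phi> \<psi>. B \<psi> \<phi> = cnj (B \<phi> \<psi>))"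

text \<open>
  In an equality of sections, \<open>(\<phi>, e(z)\<psi>)\<close> is regarded as the section over \<open>D\<close> obtained by pairing
  \<open>\<phi>\<close> with the holomorphic family \<open>e(z)\<psi>\<close>: its Taylor expansion at any point of \<open>D\<close> is the termwise
  pairing with the expansion of \<open>e(z)\<psi>\<close>. This is a condition on the form, because the
  values \<open>- du / (u - u(z))\<^sup>2\<close> alone do not span the forms with higher order poles; without it
  the form would not be determined by the conditions below.
  Likewise \<open>(e(C(z'))\<phi>, \<psi>)\<close> is a section over \<open>D'\<close>, antiholomorphic in \<open>C(z')\<close>.
\<close>

definition e_section_right :: "(WD \<Rightarrow> WD \<Rightarrow> complex) \<Rightarrow> WD \<Rightarrow> WD \<Rightarrow> bool" where
  "e_section_right B \<phi> \<psi> \<longleftrightarrow> (\<forall>a. Pt a \<in> discD \<longrightarrow>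
     (\<lambda>w. B \<phi> (e_hat (Pt (a + w)) \<psi>)) has_fps_expansion Abs_fps (\<lambda>n. B \<phi> (e_op n a \<psi>)))"

definition e_section_left :: "(WD \<Rightarrow> WD \<Rightarrow> complex) \<Rightarrow> WD \<Rightarrow> WD \<Rightarrow> bool" where
  "e_section_left B \<phi> \<psi> \<longleftrightarrow> (\<forall>a. Pt a \<in> discD \<longrightarrow>
     (\<lambda>w. B (e_hat (Pt (a + cnj w)) \<phi>) \<psi>) has_fps_expansion Abs_fps (\<lambda>n. B (e_op n a \<phi>) \<psi>))"

definition adjoint_e :: "(WD \<Rightarrow> WD \<Rightarrow> complex) \<Rightarrow> WD \<Rightarrow> WD \<Rightarrow> bool" where
  "adjoint_e B \<phi> \<psi> \<longleftrightarrow> e_section_right B \<phi> \<psi> \<and>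
     (\<forall>z\<in>discD. B \<phi> (e_hat z \<psi>) = - (C_pull z * B (i_op (Cinv z) \<phi>) \<psi>))"

definition adjoint_i :: "(WD \<Rightarrow> WD \<Rightarrow> complex) \<Rightarrow> WD \<Rightarrow> WD \<Rightarrow> bool" where
  "adjoint_i B \<phi> \<psi> \<longleftrightarrow> e_section_left B \<phi> \<psi> \<and>
     (\<forall>z\<in>discD'. B \<phi> (i_op z \<psi>) = - (C_pull z * B (e_hat (Cinv z) \<phi>) \<psi>))"

text \<open>
  The same conditions in terms of coefficients with respect to \<open>du\<close>. These are equalities of
  meromorphic functions, stated where \<open>du\<close> is a frame at both \<open>z\<close> and \<open>C(z)\<close>.
\<close>

definition adjoint_e_hat :: "(WD \<Rightarrow> WD \<Rightarrow> complex) \<Rightarrow> WD \<Rightarrow> WD \<Rightarrow> bool" where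
  "adjoint_e_hat B \<phi> \<psi> \<longleftrightarrow> e_section_right B \<phi> \<psi> \<and>
     (\<forall>z\<in>discD - {Pt 0}. (u_coord z)\<^sup>2 * B \<phi> (e_hat z \<psi>) = B (i_op (Cinv z) \<phi>) \<psi>)"

definition adjoint_i_hat :: "(WD \<Rightarrow> WD \<Rightarrow> complex) \<Rightarrow> WD \<Rightarrow> WD \<Rightarrow> bool" where
  "adjoint_i_hat B \<phi> \<psi> \<longleftrightarrow> e_section_left B \<phi> \<psi> \<and>
     (\<forall>z\<in>discD' - {Pole}. (u_coord z)\<^sup>2 * B \<phi> (i_op z \<psi>) = B (e_hat (Cinv z) \<phi>) \<psi>)"

end

theory Submission
  imports Defs "HOL-Library.Multiset"
begin

text \<open>
  The conditions determine the form in degree one. Let \<open>vfun \<alpha>\<close> be the coefficient of \<open>\<alpha>\<close> with respect to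
  \<open>dv\<close>, where \<open>v = 1/u\<close>; it is holomorphic near \<open>|v| \<le> 1\<close>. Condition (i), applied to \<open>\<alpha>\<close> and the vacuum, reads
  \<open>(\<alpha>, e_a) = cnj (vfun \<alpha> (cnj a))\<close>, where \<open>e_a = e_form 0 a\<close>. Taylor expansion in \<open>a\<close> then gives \<open>(\<alpha>, e_form n a)\<close> for all \<open>n\<close>, and the
  forms \<open>e_form n a\<close> with \<open>|a| < 1\<close> span \<open>KD\<close> by partial fractions (\<open>span_e_form\<close>), since all residues
  vanish. The same argument shows uniqueness in all degrees: \<open>(\<phi>, e_a \<psi>)\<close> is given by \<open>(i(C(a)) \<phi>, \<psi>)\<close>,
  hence \<open>(\<phi>, \<alpha> \<psi>)\<close> by the pairings with \<open>\<psi>\<close>, and \<open>(\<phi>, 1)\<close> is found by exchanging the arguments, as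
  \<open>i(z) 1 = 0\<close> (\<open>adjoint_e_unique\<close>).

  For existence, the form on \<open>KD\<close> is the Bergman inner product \<open>\<Sum>n. cnj a\<^sub>n * b\<^sub>n / (n + 1)\<close> of the functions
  \<open>vfun \<alpha> = \<Sum>n. a\<^sub>n v ^ n\<close> and \<open>vfun \<beta> = \<Sum>n. b\<^sub>n v ^ n\<close>, which is visibly hermitian and for which the form \<open>e_a\<close>
  is the reproducing kernel at \<open>cnj a\<close>.
  Every hermitian form on \<open>KD\<close> extends to the symmetric algebra so that multiplication by \<open>\<beta>\<close> is adjoint to
  the contraction with \<open>\<beta>\<close>, the derivation taking \<open>\<alpha>\<close> to \<open>(\<beta>, \<alpha>)\<close> (\<open>hermitian_structure_formW\<close>).
  The contraction with \<open>e_a\<close> and the operator \<open>i(C(a))\<close> are derivations that agree on \<open>KD\<close> up to the factor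
  from \<open>C\<^sup>*\<close>, so they agree everywhere (\<open>ann_e_form\<close>), which is condition (i); condition (ii) is its
  complex conjugate.
\<close>

section \<open>Partial fractions\<close>

interpretation KD: vector_space scaleKD
  by (rule vector_space_KD)

lemma Rep_KD_diff_eventually:
  "eventually (\<lambda>w. Rep_KD (\<alpha> - \<beta>) w = Rep_KD \<alpha> w - Rep_KD \<beta> w) (at z)"
  using Rep_KD_add_eventually[of \<alpha> "- \<beta>" z] by (simp add: Rep_KD_uminus)

lemma Rep_KD_add_analytic:
  assumes "Rep_KD \<alpha> analytic_on {z}" "Rep_KD \<beta> analytic_on {z}"
  shows "Rep_KD (\<alpha> + \<beta>) analytic_on {z}"
  unfolding Rep_KD_add by (intro remove_sings_analytic_on analytic_intros assms)

lemma Rep_KD_analytic_or_pole: "\<not> is_pole (Rep_KD \<alpha>) z \<Longrightarrow> Rep_KD \<alpha> analytic_on {z}"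
  using D_form_mero[OF Rep_KD_D_form[of \<alpha>]] nicely_meromorphic_on_imp_analytic_at by blast

lemma finite_poles_KD: "finite {z. is_pole (Rep_KD \<alpha>) z}"
proof -
  have "finite (cball 0 1 \<inter> {z. is_pole (Rep_KD \<alpha>) z})"
    by (intro finite_not_islimpt_in_compact not_islimpt_poles Rep_KD_isolated compact_cball)
  moreover have "{z. is_pole (Rep_KD \<alpha>) z} \<subseteq> cball 0 1"
    using Rep_KD_D_form[of \<alpha>] by (force simp: D_form_def discD_def dest: spec[of _ "Pt _"])
  ultimately show ?thesis
    by (simp add: Int_absorb1)
qed

text \<open>
  A form without poles is zero: its coefficient is entire, and tends to \<open>0\<close> at infinity because the
  form is holomorphic at the pole of \<open>u\<close>.
\<close>

lemma pole_free_KD: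
  assumes "\<And>z. \<not> is_pole (Rep_KD \<alpha>) z"
  shows "\<alpha> = 0"
proof -
  let ?f = "Rep_KD \<alpha>"
  have "?f holomorphic_on UNIV"
    using Rep_KD_analytic_or_pole assms analytic_imp_holomorphic
    by (metis analytic_on_analytic_at)
  moreover have "(?f \<longlongrightarrow> 0) at_infinity"
    unfolding lim_at_infinity_0
  proof (rule Lim_transform_eventually)
    have "(\<lambda>v. - (v ^ 2 * v_coeff ?f v)) \<midarrow>0\<rightarrow> - (0 ^ 2 * form_coeff ?f Pole)"
      by (intro tendsto_intros D_form_tendsto_Pole Rep_KD_D_form)
    then show "(\<lambda>v. - (v ^ 2 * v_coeff ?f v)) \<midarrow>0\<rightarrow> 0" by simp
    show "eventually (\<lambda>v. - (v ^ 2 * v_coeff ?f v) = (?f \<circ> inverse) v) (at 0)"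
      using eventually_neq_at_within[of 0 0 UNIV]
      by eventually_elim (simp add: v_coeff_def field_simps)
  qed
  ultimately have "?f z = 0" for z
    by (rule Liouville_weak_0)
  then show ?thesis
    by (simp add: fun_eq_iff Rep_KD_zero flip: Rep_KD_inject)
qed

lemma analytic_at_factor:
  assumes "g analytic_on {p}"
  obtains h where "h analytic_on {p}" "\<And>w :: complex. g w = g p + (w - p) * h w"
proof -
  define h where "h w = (if w = p then deriv g p else (g w - g p) / (w - p))" for w
  obtain S where "open S" "p \<in> S" "g holomorphic_on S"
    using assms analytic_at by blast
  then have "h analytic_on {p}"
    unfolding h_def[abs_def] using pole_lemma_open analytic_at by blast
  then show thesis
    using that[of h] by (simp add: h_def)
qed

lemma principal_part_analytic:
  assumes "\<beta> \<in> KD.span {e_form n p |n. True}" "norm p < 1" "q \<noteq> p"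
  shows "Rep_KD \<beta> analytic_on {q}"
  using assms(1)
proof (induction rule: KD.span_induct_alt)
  case base
  show ?case by (simp add: Rep_KD_zero)
next
  case (step c \<gamma> \<beta>)
  then obtain n where "\<gamma> = e_form n p" by auto
  moreover have "(\<lambda>u. c * (- of_nat (Suc n) / (u - p) ^ (n + 2))) analytic_on {q}"
    using assms(3) by (intro analytic_intros) auto
  ultimately show ?case
    using step.IH assms(2) by (intro Rep_KD_add_analytic) (simp_all add: Rep_KD_scale Rep_e_form)
qed

text \<open>
  The forms \<open>e_form n p\<close> have poles of order at least \<open>2\<close> at \<open>p\<close>. They lower the order of a pole step by
  step down to a simple pole, which vanishing of the residue excludes.
\<close>

lemma subtract_principal_part:
  assumes "norm p < 1" "g analytic_on {p}"
    and "eventually (\<lambda>w. Rep_KD \<alpha> w = g w / (w - p) ^ N) (at p)"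
  shows "\<exists>\<beta>\<in>KD.span {e_form n p |n. True}. \<not> is_pole (Rep_KD (\<alpha> - \<beta>)) p"
  using assms(2,3)
proof (induction N arbitrary: g \<alpha>)
  case 0
  then have "\<not> is_pole (Rep_KD (\<alpha> - 0)) p"
    using analytic_at_imp_no_pole[of g p] is_pole_cong[of "Rep_KD \<alpha>" g p p] by simp
  then show ?case
    using KD.span_zero by blast
next
  case (Suc N)
  obtain h where h: "h analytic_on {p}" "\<And>w. g w = g p + (w - p) * h w"
    using analytic_at_factor[OF Suc.prems(1)] by blast
  have ne: "eventually (\<lambda>w. w \<noteq> p) (at p)"
    by (rule eventually_neq_at_within)
  show ?case
  proof (cases N)
    case 0
    obtain S where S: "open S" "p \<in> S" "g holomorphic_on S"
      using Suc.prems(1) analytic_at by blast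
    have "residue (Rep_KD \<alpha>) p = residue (\<lambda>w. g w / (w - p)) p"
      using Suc.prems(2) 0 by (intro residue_cong) auto
    also have "\<dots> = g p"
      using S by (rule residue_simple)
    finally have "g p = 0"
      using Rep_KD_D_form[of \<alpha>] by (auto simp: D_form_def dest: spec[of _ "Pt p"])
    have "eventually (\<lambda>w. Rep_KD \<alpha> w = h w / (w - p) ^ N) (at p)"
      using Suc.prems(2) ne
    proof eventually_elim
      case (elim w)
      then show ?case using h(2)[of w] \<open>g p = 0\<close> 0 by simp
    qed
    then show ?thesis
      by (rule Suc.IH[OF h(1)])
  next
    case (Suc n)
    \<comment> \<open>\<open>\<gamma>\<close> is the leading term \<open>g p / (w - p) ^ (n + 2)\<close> of \<open>\<alpha>\<close> at \<open>p\<close>\<close>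
    define c where "c = - g p / of_nat (Suc n)"
    define \<gamma> where "\<gamma> = scaleKD c (e_form n p)"
    have c: "c * of_nat (Suc n) = - g p"
      by (simp add: c_def del: of_nat_Suc)
    have "eventually (\<lambda>w. Rep_KD (\<alpha> - \<gamma>) w = h w / (w - p) ^ N) (at p)"
      using Rep_KD_diff_eventually[of \<alpha> \<gamma> p] Suc.prems(2) ne
    proof eventually_elim
      case (elim w)
      have "Rep_KD \<gamma> w = - (c * of_nat (Suc n)) / (w - p) ^ Suc N"
        using assms(1) Suc by (simp add: \<gamma>_def Rep_KD_scale Rep_e_form del: of_nat_Suc)
      then have "Rep_KD (\<alpha> - \<gamma>) w = (g w - g p) / (w - p) ^ Suc N"
        unfolding elim c by (simp add: diff_divide_distrib)
      also have "\<dots> = h w / (w - p) ^ N"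
        using elim h(2)[of w] by simp
      finally show ?case .
    qed
    from Suc.IH[OF h(1) this] obtain \<beta>
      where \<beta>: "\<beta> \<in> KD.span {e_form n p |n. True}" "\<not> is_pole (Rep_KD (\<alpha> - \<gamma> - \<beta>)) p" by blast
    have "\<gamma> + \<beta> \<in> KD.span {e_form n p |n. True}"
      unfolding \<gamma>_def by (intro KD.span_add KD.span_scale KD.span_base \<beta>) auto
    then show ?thesis
      using \<beta>(2) by (metis diff_diff_eq)
  qed
qed

text \<open>
  Partial fractions, by induction on the number of poles.
\<close>

lemma span_e_form: "\<alpha> \<in> KD.span {e_form n a |n a. norm a < 1}"
proof (induction "card {z. is_pole (Rep_KD \<alpha>) z}" arbitrary: \<alpha> rule: less_induct)
  case (less \<alpha>)
  show ?case
  proof (cases "\<exists>p. is_pole (Rep_KD \<alpha>) p")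
    case False
    then show ?thesis
      using pole_free_KD[of \<alpha>] KD.span_zero by auto
  next
    case True
    then obtain p where p: "is_pole (Rep_KD \<alpha>) p" by blast
    then have "norm p < 1"
      using Rep_KD_D_form[of \<alpha>] by (force simp: D_form_def discD_def dest: spec[of _ "Pt p"])
    obtain r where r: "r > 0" "Rep_KD \<alpha> holomorphic_on ball p r - {p}"
      using Rep_KD_isolated[of \<alpha> p] analytic_imp_holomorphic
      unfolding isolated_singularity_at_def by blast
    obtain g s N where g: "s > 0" "g holomorphic_on cball p s"
      "\<And>w. w \<in> cball p s - {p} \<Longrightarrow> Rep_KD \<alpha> w = g w / (w - p) ^ N"
      using zorder_exist_pole[OF r(2) _ _ p] r(1) by auto
    have "g analytic_on {p}"
      using g(1,2) analytic_at holomorphic_on_subset[OF g(2) ball_subset_cball]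
      by (metis centre_in_ball open_ball)
    moreover have "eventually (\<lambda>w. w \<in> ball p s - {p}) (at p)"
      using g(1) by (intro eventually_at_in_open) auto
    then have "eventually (\<lambda>w. Rep_KD \<alpha> w = g w / (w - p) ^ N) (at p)"
      by eventually_elim (auto intro: g(3))
    ultimately obtain \<beta> where \<beta>: "\<beta> \<in> KD.span {e_form n p |n. True}"
      "\<not> is_pole (Rep_KD (\<alpha> - \<beta>)) p"
      using subtract_principal_part[OF \<open>norm p < 1\<close>] by blast
    have "\<not> is_pole (Rep_KD (\<alpha> - \<beta>)) q" if "\<not> is_pole (Rep_KD \<alpha>) q" "q \<noteq> p" for q
    proof -
      have "Rep_KD (- \<beta>) analytic_on {q}"
        unfolding Rep_KD_uminus
        using principal_part_analytic[OF \<beta>(1) \<open>norm p < 1\<close> that(2)] by (rule analytic_on_neg)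
      then have "Rep_KD (\<alpha> - \<beta>) analytic_on {q}"
        unfolding diff_conv_add_uminus
        using Rep_KD_analytic_or_pole[OF that(1)] by (intro Rep_KD_add_analytic)
      then show ?thesis
        by (rule analytic_at_imp_no_pole)
    qed
    then have "{z. is_pole (Rep_KD (\<alpha> - \<beta>)) z} \<subset> {z. is_pole (Rep_KD \<alpha>) z}"
      using p \<beta>(2) by blast
    then have "\<alpha> - \<beta> \<in> KD.span {e_form n a |n a. norm a < 1}"
      by (intro less psubset_card_mono finite_poles_KD)
    moreover have "\<beta> \<in> KD.span {e_form n a |n a. norm a < 1}"
      using \<beta>(1) KD.span_mono[of "{e_form n p |n. True}" "{e_form n a |n a. norm a < 1}"]
        \<open>norm p < 1\<close> by blast
    ultimately show ?thesis
      using KD.span_add by fastforce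
  qed
qed

lemma KD_induct [case_names zero add scale e_form]:
  assumes "P 0" "\<And>\<alpha> \<beta>. P \<alpha> \<Longrightarrow> P \<beta> \<Longrightarrow> P (\<alpha> + \<beta>)" "\<And>c \<alpha>. P \<alpha> \<Longrightarrow> P (scaleKD c \<alpha>)"
    and "\<And>n a. norm a < 1 \<Longrightarrow> P (e_form n a)"
  shows "P \<alpha>"
  using span_e_form[of \<alpha>]
  by (induction rule: KD.span_induct_alt) (use assms in auto)

section \<open>Hermitian forms on the symmetric algebra\<close>

lemma scaleW_simps:
  "scaleW c (\<phi> + \<psi>) = scaleW c \<phi> + scaleW c \<psi>" "scaleW (c + d) \<phi> = scaleW c \<phi> + scaleW d \<phi>"
  "scaleW c (scaleW d \<phi>) = scaleW (c * d) \<phi>" "scaleW 1 \<phi> = \<phi>" "scaleW 0 \<phi> = 0" "scaleW c 0 = 0"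
  "scaleW c \<phi> * \<psi> = scaleW c (\<phi> * \<psi>)" "\<phi> * scaleW c \<psi> = scaleW c (\<phi> * \<psi>)"
  by (simp_all add: scaleW_def constW_simps algebra_simps)

text \<open>
  The component of degree zero, that is the coefficient of the vacuum \<open>1\<close>.
\<close>

lift_definition vacW :: "WD \<Rightarrow> complex" is "\<lambda>p. Poly_Mapping.lookup p 0"
proof -
  fix p q :: free_alg
  assume "sym_rel p q"
  then have "p - q \<in> sym_ideal"
    by (simp add: sym_rel_def)
  then have "Poly_Mapping.lookup (p - q) 0 = 0"
    by (induction rule: sym_ideal_induct)
       (auto simp: lookup_add lookup_minus lookup_mult_zero free_var_def lookup_single when_def
         poly_mapping_eq_iff fun_eq_iff)
  then show "Poly_Mapping.lookup p 0 = Poly_Mapping.lookup q 0"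
    by (simp add: lookup_minus)
qed

lemma vacW_simps [simp]:
  "vacW 0 = 0" "vacW 1 = 1" "vacW (\<phi> + \<psi>) = vacW \<phi> + vacW \<psi>"
  "vacW (scaleW c \<phi>) = c * vacW \<phi>" "vacW (inclW \<alpha> * \<phi>) = 0"
proof -
  show "vacW 0 = 0" "vacW 1 = 1" "vacW (\<phi> + \<psi>) = vacW \<phi> + vacW \<psi>"
    by (transfer; simp add: lookup_one lookup_add)+
  show "vacW (scaleW c \<phi>) = c * vacW \<phi>"
    unfolding scaleW_def by transfer (simp add: lookup_mult_zero free_const_def)
  have "Poly_Mapping.lookup (free_var \<alpha>) 0 = 0"
    by (auto simp: free_var_def lookup_single when_def poly_mapping_eq_iff fun_eq_iff)
  then show "vacW (inclW \<alpha> * \<phi>) = 0"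
    by transfer (simp add: lookup_mult_zero)
qed

text \<open>
  The derivation that extends a linear functional on \<open>KD\<close>; meaningless if \<open>g\<close> is not linear.
\<close>

definition contractW :: "(KD \<Rightarrow> complex) \<Rightarrow> WD \<Rightarrow> WD" where
  "contractW g = (SOME \<delta>. derivation \<delta> \<and> (\<forall>\<alpha>. \<delta> (inclW \<alpha>) = scaleW (g \<alpha>) 1))"

lemma contractW:
  assumes "\<And>\<alpha> \<beta>. g (\<alpha> + \<beta>) = g \<alpha> + g \<beta>" "\<And>c \<alpha>. g (scaleKD c \<alpha>) = c * g \<alpha>"
  shows "derivation (contractW g)" "contractW g (inclW \<alpha>) = scaleW (g \<alpha>) 1"
proof -
  have "vector_space ((*) :: complex \<Rightarrow> complex \<Rightarrow> complex)"
    by unfold_locales (simp_all add: algebra_simps)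
  then have "Vector_Spaces.linear scaleKD (*) g"
    unfolding Vector_Spaces.linear_iff using assms vector_space_KD by simp
  from someI_ex[OF derivation_exists[OF this]]
  show "derivation (contractW g)" "contractW g (inclW \<alpha>) = scaleW (g \<alpha>) 1"
    unfolding contractW_def by auto
qed

text \<open>
  A monomial, given by its exponents, as the multiset of its factors.
\<close>

definition mset_of_mono :: "('a \<Rightarrow>\<^sub>0 nat) \<Rightarrow> 'a multiset" where
  "mset_of_mono m = Abs_multiset (Poly_Mapping.lookup m)"

lemma mset_of_mono_simps [simp]:
  "mset_of_mono (0 :: 'a \<Rightarrow>\<^sub>0 nat) = {#}"
  "mset_of_mono (Poly_Mapping.single (\<alpha> :: 'a) (Suc 0) + m) = add_mset \<alpha> (mset_of_mono m)"
proof -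
  have count: "count (mset_of_mono k) = Poly_Mapping.lookup k" for k :: "'a \<Rightarrow>\<^sub>0 nat"
    unfolding mset_of_mono_def by (rule count_Abs_multiset) (use finite_lookup[of k] in auto)
  show "mset_of_mono (0 :: 'a \<Rightarrow>\<^sub>0 nat) = {#}"
    by (rule multiset_eqI) (simp add: count)
  show "mset_of_mono (Poly_Mapping.single (\<alpha> :: 'a) (Suc 0) + m) = add_mset \<alpha> (mset_of_mono m)"
    by (rule multiset_eqI) (simp add: count lookup_add lookup_single when_def)
qed

text \<open>
  A hermitian form on \<open>KD\<close>, antilinear in the first argument. It is extended to the symmetric
  algebra by letting multiplication by \<open>\<beta>\<close> be adjoint to the contraction with \<open>\<beta>\<close>.
\<close>

locale hermitian_KD =
  fixes b :: "KD \<Rightarrow> KD \<Rightarrow> complex"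
  assumes add_right: "b \<alpha> (\<beta> + \<gamma>) = b \<alpha> \<beta> + b \<alpha> \<gamma>"
    and scale_right: "b \<alpha> (scaleKD c \<beta>) = c * b \<alpha> \<beta>"
    and hermitian: "b \<beta> \<alpha> = cnj (b \<alpha> \<beta>)"
begin

lemma add_left: "b (\<alpha> + \<beta>) \<gamma> = b \<alpha> \<gamma> + b \<beta> \<gamma>"
  by (metis add_right hermitian complex_cnj_add)

lemma scale_left: "b (scaleKD c \<alpha>) \<beta> = cnj c * b \<alpha> \<beta>"
  by (metis scale_right hermitian complex_cnj_mult)

text \<open>
  The contraction with \<open>\<beta>\<close> (the annihilation operator), antilinear in \<open>\<beta>\<close>.
\<close>

definition ann :: "KD \<Rightarrow> WD \<Rightarrow> WD" where
  "ann \<beta> = contractW (b \<beta>)"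

lemma ann_derivation: "derivation (ann \<beta>)"
  and ann_inclW: "ann \<beta> (inclW \<alpha>) = scaleW (b \<beta> \<alpha>) 1"
  unfolding ann_def using contractW[of "b \<beta>"] add_right scale_right by auto

lemmas ann_simps = derivationD[OF ann_derivation] ann_inclW

lemma ann_add: "ann (\<alpha> + \<beta>) \<phi> = ann \<alpha> \<phi> + ann \<beta> \<phi>"
  by (induction \<phi> rule: WD_induct) (simp_all add: ann_simps add_left scaleW_simps algebra_simps)

lemma ann_scale: "ann (scaleKD c \<alpha>) \<phi> = scaleW (cnj c) (ann \<alpha> \<phi>)"
  by (induction \<phi> rule: WD_induct)
     (simp_all add: ann_simps scale_left scaleW_simps mult.commute)

lemma ann_commute: "ann \<alpha> (ann \<beta> \<phi>) = ann \<beta> (ann \<alpha> \<phi>)"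
  by (induction \<phi> rule: WD_induct) (simp_all add: ann_simps scaleW_simps algebra_simps)

sublocale ann: comp_fun_commute ann
  by unfold_locales (simp add: fun_eq_iff ann_commute)

text \<open>
  The composite of the contractions with the factors of a monomial. The order of the factors is
  irrelevant, because contractions commute.
\<close>

definition ann_mono :: "(KD \<Rightarrow>\<^sub>0 nat) \<Rightarrow> WD \<Rightarrow> WD" where
  "ann_mono m \<psi> = fold_mset ann \<psi> (mset_of_mono m)"

lemma ann_mono_linear:
  "ann_mono m (\<phi> + \<psi>) = ann_mono m \<phi> + ann_mono m \<psi>"
  "ann_mono m (scaleW c \<phi>) = scaleW c (ann_mono m \<phi>)"
proof -
  have "fold_mset ann (\<phi> + \<psi>) M = fold_mset ann \<phi> M + fold_mset ann \<psi> M"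
    and "fold_mset ann (scaleW c \<phi>) M = scaleW c (fold_mset ann \<phi> M)" for M
    by (induction M) (simp_all add: ann_simps)
  then show "ann_mono m (\<phi> + \<psi>) = ann_mono m \<phi> + ann_mono m \<psi>"
    "ann_mono m (scaleW c \<phi>) = scaleW c (ann_mono m \<phi>)"
    by (simp_all add: ann_mono_def)
qed

text \<open>
  The antilinear action of polynomials by contractions, followed by projection to degree zero. By
  \<open>free_pairing_sym_ideal\<close> it descends to the symmetric algebra in its first argument.
\<close>

definition free_pairing :: "free_alg \<Rightarrow> WD \<Rightarrow> complex" where
  "free_pairing p \<psi> =
     (\<Sum>m\<in>Poly_Mapping.keys p. cnj (Poly_Mapping.lookup p m) * vacW (ann_mono m \<psi>))"

lemma free_pairing_superset:
  assumes "finite S" "Poly_Mapping.keys p \<subseteq> S"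
  shows "free_pairing p \<psi> = (\<Sum>m\<in>S. cnj (Poly_Mapping.lookup p m) * vacW (ann_mono m \<psi>))"
  unfolding free_pairing_def
  by (rule sum.mono_neutral_left) (use assms in \<open>auto simp: in_keys_iff\<close>)

lemma free_pairing_zero: "free_pairing 0 \<psi> = 0"
  by (simp add: free_pairing_def)

lemma free_pairing_single:
  "free_pairing (Poly_Mapping.single m c) \<psi> = cnj c * vacW (ann_mono m \<psi>)"
  by (subst free_pairing_superset[of "{m}"]) auto

lemma free_pairing_add: "free_pairing (p + q) \<psi> = free_pairing p \<psi> + free_pairing q \<psi>"
  by (simp add: free_pairing_superset[of "Poly_Mapping.keys p \<union> Poly_Mapping.keys q"]
      keys_add lookup_add sum.distrib ring_distribs)

lemma free_pairing_diff: "free_pairing (p - q) \<psi> = free_pairing p \<psi> - free_pairing q \<psi>"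
  using free_pairing_add[of "p - q" q \<psi>] by simp

lemma free_pairing_linear:
  "free_pairing p (\<phi> + \<psi>) = free_pairing p \<phi> + free_pairing p \<psi>"
  "free_pairing p (scaleW c \<phi>) = c * free_pairing p \<phi>"
  by (simp_all add: free_pairing_def ann_mono_linear ring_distribs sum.distrib sum_distrib_left
      mult_ac)

lemma free_pairing_const: "free_pairing (free_const c * p) \<psi> = cnj c * free_pairing p \<psi>"
  by (induction p rule: free_alg_induct)
     (simp_all add: free_pairing_zero ring_distribs free_pairing_add free_pairing_single
        free_const_def mult_single)

lemma free_pairing_var: "free_pairing (free_var \<beta> * p) \<psi> = free_pairing p (ann \<beta> \<psi>)"
proof (induction p rule: free_alg_induct)
  case (2 p c m)
  have "ann_mono (Poly_Mapping.single \<beta> (Suc 0) + m) \<psi> = ann_mono m (ann \<beta> \<psi>)"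
    by (simp add: ann_mono_def ann.fold_mset_fun_left_comm)
  with 2 show ?case
    by (simp add: ring_distribs free_pairing_add free_pairing_single free_var_def mult_single)
qed (simp add: free_pairing_zero)

text \<open>
  The contraction depends antilinearly on its index, so the relations that define the symmetric
  algebra act by zero. The induction needs the statement for all multiples of \<open>p\<close>.
\<close>

lemma free_pairing_sym_ideal:
  assumes "p \<in> sym_ideal"
  shows "free_pairing p \<psi> = 0"
proof -
  have "free_pairing (r * p) \<psi> = 0" for r
    using assms
  proof (induction arbitrary: r rule: sym_ideal_induct)
    case (mult p s)
    from mult[of "r * s"] show ?case by (simp add: mult.assoc)
  next
    case (var_add \<alpha> \<beta>)
    have "r * (free_var (\<alpha> + \<beta>) - free_var \<alpha> - free_var \<beta>) =
        free_var (\<alpha> + \<beta>) * r - free_var \<alpha> * r - free_var \<beta> * r"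
      by (simp add: algebra_simps)
    then show ?case
      by (simp add: free_pairing_diff free_pairing_var ann_add free_pairing_linear)
  next
    case (var_scale c \<alpha>)
    have "r * (free_var (scaleKD c \<alpha>) - free_const c * free_var \<alpha>) =
        free_var (scaleKD c \<alpha>) * r - free_const c * (free_var \<alpha> * r)"
      by (simp add: algebra_simps)
    then show ?case
      by (simp add: free_pairing_diff free_pairing_var free_pairing_const ann_scale
          free_pairing_linear)
  qed (simp_all add: free_pairing_zero ring_distribs free_pairing_add)
  from this[of 1] show ?thesis by simp
qed

text \<open>
  The extension of the hermitian form to the symmetric algebra.
\<close>

definition formW :: "WD \<Rightarrow> WD \<Rightarrow> complex" where
  "formW \<phi> \<psi> = free_pairing (rep_WD \<phi>) \<psi>"

lemma formW_abs: "formW (abs_WD p) \<psi> = free_pairing p \<psi>"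
proof -
  have "sym_rel (rep_WD (abs_WD p)) p"
    using Quotient3_WD sym_rel_equivp by (metis Quotient3_rep_abs equivp_reflp)
  then have "free_pairing (rep_WD (abs_WD p) - p) \<psi> = 0"
    by (intro free_pairing_sym_ideal) (simp add: sym_rel_def)
  then show ?thesis
    by (simp add: formW_def free_pairing_diff)
qed

lemma formW_linear_right:
  "formW \<phi> (\<psi> + \<xi>) = formW \<phi> \<psi> + formW \<phi> \<xi>" "formW \<phi> (scaleW c \<psi>) = c * formW \<phi> \<psi>"
  by (simp_all add: formW_def free_pairing_linear)

lemma formW_antilinear_left:
  "formW (\<phi> + \<xi>) \<psi> = formW \<phi> \<psi> + formW \<xi> \<psi>" "formW (scaleW c \<phi>) \<psi> = cnj c * formW \<phi> \<psi>"
  and formW_one_left: "formW 1 \<psi> = vacW \<psi>"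
  and formW_inclW_left: "formW (inclW \<beta> * \<phi>) \<psi> = formW \<phi> (ann \<beta> \<psi>)"
proof -
  obtain p q where [simp]: "\<phi> = abs_WD p" "\<xi> = abs_WD q"
    by (metis Quotient3_WD Quotient3_abs_rep)
  show "formW (\<phi> + \<xi>) \<psi> = formW \<phi> \<psi> + formW \<xi> \<psi>"
    by (simp add: plus_WD.abs_eq formW_abs free_pairing_add)
  show "formW (scaleW c \<phi>) \<psi> = cnj c * formW \<phi> \<psi>"
    by (simp add: scaleW_def constW.abs_eq times_WD.abs_eq formW_abs free_pairing_const)
  show "formW (inclW \<beta> * \<phi>) \<psi> = formW \<phi> (ann \<beta> \<psi>)"
    by (simp add: inclW.abs_eq times_WD.abs_eq formW_abs free_pairing_var)
  show "formW 1 \<psi> = vacW \<psi>"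
    by (simp add: one_WD.abs_eq formW_abs free_pairing_single ann_mono_def flip: single_one)
qed

lemma formW_zero [simp]: "formW \<phi> 0 = 0" "formW 0 \<psi> = 0"
  using formW_linear_right(2)[of \<phi> 0 0] formW_antilinear_left(2)[of 0 0 \<psi>]
  by (simp_all add: scaleW_simps)

text \<open>
  In the first argument, multiplication is adjoint to contraction by construction (\<open>formW_inclW_left\<close>);
  in the second argument this rests on the hermitian symmetry of \<open>b\<close>.
\<close>

lemma formW_inclW_right: "formW \<phi> (inclW \<beta> * \<psi>) = formW (ann \<beta> \<phi>) \<psi>"
proof (induction \<phi> arbitrary: \<psi> rule: WD_induct)
  case one
  show ?case by (simp add: formW_one_left ann_simps)
next
  case (incl_mult \<alpha> \<phi>)
  have "formW (inclW \<alpha> * \<phi>) (inclW \<beta> * \<psi>) = b \<alpha> \<beta> * formW \<phi> \<psi> + formW (ann \<beta> \<phi>) (ann \<alpha> \<psi>)"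
    by (simp add: formW_inclW_left ann_simps formW_linear_right incl_mult scaleW_simps)
  also have "\<dots> = formW (ann \<beta> (inclW \<alpha> * \<phi>)) \<psi>"
    by (simp add: formW_inclW_left ann_simps formW_antilinear_left scaleW_simps hermitian[of \<alpha> \<beta>])
  finally show ?case .
qed (simp_all add: ann_simps formW_antilinear_left)

lemma formW_hermitian: "formW \<psi> \<phi> = cnj (formW \<phi> \<psi>)"
proof (induction \<phi> arbitrary: \<psi> rule: WD_induct)
  case one
  show ?case
    by (induction \<psi> rule: WD_induct)
       (simp_all add: formW_one_left formW_inclW_left ann_simps formW_antilinear_left)
next
  case (incl_mult \<alpha> \<phi>)
  show ?case
    unfolding formW_inclW_left formW_inclW_right by (rule incl_mult)
qed (simp_all add: formW_linear_right formW_antilinear_left)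

lemma hermitian_structure_formW: "hermitian_structure formW"
  unfolding hermitian_structure_def
  by (intro conjI allI formW_linear_right formW_antilinear_left formW_hermitian)

end

section \<open>The Bergman inner product\<close>

text \<open>
  The power series of \<open>z \<mapsto> cnj (f (cnj z))\<close>, if \<open>F\<close> is the power series of \<open>f\<close>.
\<close>

definition cnj_fps :: "complex fps \<Rightarrow> complex fps" where
  "cnj_fps F = Abs_fps (\<lambda>n. cnj (fps_nth F n))"

lemma cnj_fps_nth [simp]: "fps_nth (cnj_fps F) n = cnj (fps_nth F n)"
  by (simp add: cnj_fps_def)

lemma conv_radius_cnj_fps [simp]: "fps_conv_radius (cnj_fps F) = fps_conv_radius F"
  by (simp add: fps_conv_radius_def conv_radius_def cnj_fps_def)

lemma eval_cnj_fps:
  assumes "norm z < fps_conv_radius F"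
  shows "eval_fps (cnj_fps F) z = cnj (eval_fps F (cnj z))"
proof -
  have "summable (\<lambda>n. fps_nth F n * cnj z ^ n)"
    using assms by (intro summable_fps) simp
  from bounded_linear.suminf[OF bounded_linear_cnj this] show ?thesis
    by (simp add: eval_fps_def)
qed

lemma has_fps_expansion_cnj:
  assumes "f has_fps_expansion F"
  shows "(\<lambda>w. cnj (f (cnj w))) has_fps_expansion cnj_fps F"
proof -
  have pos: "fps_conv_radius F > 0" and ev: "eventually (\<lambda>z. eval_fps F z = f z) (nhds 0)"
    using assms by (auto simp: has_fps_expansion_def)
  have "filterlim cnj (nhds 0) (nhds (0 :: complex))"
    using tendsto_cnj[OF tendsto_ident_at, of 0 UNIV] by (simp add: tendsto_nhds_iff)
  with ev have "eventually (\<lambda>z. eval_fps F (cnj z) = f (cnj z)) (nhds 0)"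
    by (rule eventually_compose_filterlim)
  moreover have "eventually (\<lambda>z. z \<in> eball 0 (fps_conv_radius F)) (nhds 0)"
    using pos by (intro eventually_nhds_in_open) (auto simp: zero_ereal_def)
  ultimately have "eventually (\<lambda>z. eval_fps (cnj_fps F) z = cnj (f (cnj z))) (nhds 0)"
    by eventually_elim (simp add: eval_cnj_fps)
  then show ?thesis
    using pos by (simp add: has_fps_expansion_def)
qed

lemma fps_nth_deriv_funpow:
  "fps_nth ((fps_deriv ^^ k) F) n = fact k * of_nat ((n + k) choose k) * fps_nth F (n + k)"
  for F :: "complex fps"
proof (induction k arbitrary: n)
  case (Suc k)
  have "Suc k * (Suc (n + k) choose Suc k) = (Suc n) * (Suc (n + k) choose k)"
    using binomial_absorb_comp[of "Suc (n + k)" k] Suc_times_binomial_eq[of "n + k" k]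
    by (simp add: mult.commute)
  then have "(of_nat (Suc k) * of_nat (Suc (n + k) choose Suc k) :: complex) =
        of_nat (Suc n) * of_nat (Suc (n + k) choose k)"
    by (metis of_nat_mult)
  then show ?case
    using Suc[of "Suc n"] by (simp add: mult_ac del: of_nat_Suc binomial_Suc_Suc)
qed simp

text \<open>
  Expansion of a power series about another point of its disc of convergence. The terms with \<open>n < k\<close>
  are zero because the binomial coefficient is.
\<close>

lemma has_fps_expansion_recentre:
  fixes F :: "complex fps"
  assumes "norm a < fps_conv_radius F"
  shows "(\<lambda>w. eval_fps F (a + w)) has_fps_expansion
           Abs_fps (\<lambda>k. suminf (\<lambda>n. fps_nth F n * of_nat (n choose k) * a ^ (n - k)))"
proof -
  have deriv: "(deriv ^^ k) (eval_fps G) a = eval_fps ((fps_deriv ^^ k) G) a"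
    if "norm a < fps_conv_radius G" for k G
    using that
  proof (induction k arbitrary: G)
    case (Suc k)
    have "eventually (\<lambda>z. z \<in> eball 0 (fps_conv_radius G)) (nhds a)"
      using Suc.prems by (intro eventually_nhds_in_open) auto
    then have "eventually (\<lambda>z. deriv (eval_fps G) z = eval_fps (fps_deriv G) z) (nhds a)"
      by eventually_elim (simp add: eval_fps_deriv)
    then have "(deriv ^^ k) (deriv (eval_fps G)) a = (deriv ^^ k) (eval_fps (fps_deriv G)) a"
      by (intro higher_deriv_cong_ev refl)
    also have "\<dots> = eval_fps ((fps_deriv ^^ k) (fps_deriv G)) a"
      using Suc.prems fps_conv_radius_deriv[of G] by (intro Suc.IH) (meson less_le_trans)
    finally show ?case
      by (simp add: funpow_Suc_right del: funpow.simps)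
  qed simp
  have conv: "fps_conv_radius F \<le> fps_conv_radius ((fps_deriv ^^ k) F)" for k
    by (induction k) (auto intro: order_trans fps_conv_radius_deriv)
  have coeff: "(deriv ^^ k) (eval_fps F) a / fact k =
      suminf (\<lambda>n. fps_nth F n * of_nat (n choose k) * a ^ (n - k))" (is "_ = suminf ?f") for k
  proof -
    have "summable (\<lambda>n. fps_nth ((fps_deriv ^^ k) F) n * a ^ n)"
      using assms conv[of k] by (intro summable_fps) (meson less_le_trans)
    then have "(\<lambda>n. fps_nth ((fps_deriv ^^ k) F) n * a ^ n / fact k) sums
        (eval_fps ((fps_deriv ^^ k) F) a / fact k)"
      unfolding eval_fps_def by (intro sums_divide summable_sums)
    then have "(\<lambda>n. ?f (n + k)) sums (eval_fps ((fps_deriv ^^ k) F) a / fact k)"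
      by (simp add: fps_nth_deriv_funpow mult_ac)
    then have "?f sums (eval_fps ((fps_deriv ^^ k) F) a / fact k)"
      by (subst (asm) sums_iff_shift) (simp add: binomial_eq_0)
    then show ?thesis
      by (simp add: sums_iff deriv[OF assms])
  qed
  have "open (eball 0 (fps_conv_radius F))" "a \<in> eball 0 (fps_conv_radius F)"
    using assms by simp_all
  then obtain r where r: "r > 0" "ball a r \<subseteq> eball 0 (fps_conv_radius F)"
    using open_contains_ball by blast
  have "(\<lambda>w. a + w) ` ball 0 r \<subseteq> eball 0 (fps_conv_radius F)"
    using r(2) by (auto simp: subset_iff dist_norm)
  then have "(eval_fps F \<circ> (\<lambda>w. a + w)) holomorphic_on ball 0 r"
    by (intro holomorphic_on_compose_gen[OF _ holomorphic_on_eval_fps[OF order_refl]]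
        holomorphic_intros) auto
  then have "(\<lambda>w. eval_fps F (a + w)) has_fps_expansion fps_expansion (\<lambda>w. eval_fps F (a + w)) 0"
    using r(1) by (intro has_fps_expansion_fps_expansion[of "ball 0 r"]) (auto simp: o_def)
  also have "fps_expansion (\<lambda>w. eval_fps F (a + w)) 0 =
      Abs_fps (\<lambda>k. suminf (\<lambda>n. fps_nth F n * of_nat (n choose k) * a ^ (n - k)))"
    unfolding fps_expansion_def coeff[symmetric] higher_deriv_shift_0[of _ _ a] o_def ..
  finally show ?thesis .
qed

text \<open>
  The coefficient of a form with respect to \<open>dv\<close>, as a function of \<open>v = 1/u\<close>. It is holomorphic in a
  neighbourhood of the closed disc \<open>|v| \<le> 1\<close>, because the poles of the form lie in \<open>|u| < 1\<close>. The junk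
  value of \<open>v_coeff\<close> at \<open>v = 0\<close> is corrected by \<open>remove_sings\<close>.
\<close>

definition vfun :: "KD \<Rightarrow> complex \<Rightarrow> complex" where
  "vfun \<alpha> = remove_sings (v_coeff (Rep_KD \<alpha>))"

lemma
  assumes "norm v \<le> 1"
  shows vfun_analytic: "vfun \<alpha> analytic_on {v}"
    and vfun_eq: "vfun \<alpha> v = (if v = 0 then form_coeff (Rep_KD \<alpha>) Pole
                     else - form_coeff (Rep_KD \<alpha>) (Pt (1 / v)) / v\<^sup>2)"
proof -
  have "vfun \<alpha> analytic_on {v} \<and> (v \<noteq> 0 \<longrightarrow> vfun \<alpha> v = v_coeff (Rep_KD \<alpha>) v)"
  proof (cases "v = 0")
    case True
    have "v_coeff (Rep_KD \<alpha>) meromorphic_on {0}"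
      using Rep_KD_D_form[of \<alpha>] by (simp add: D_form_def mero_form_def)
    then show ?thesis
      using True D_form_tendsto_Pole[OF Rep_KD_D_form[of \<alpha>]] meromorphic_at_iff
      unfolding vfun_def by (auto intro!: remove_sings_analytic_at)
  next
    case False
    have "norm (1 / v) \<ge> 1"
      using False assms by (simp add: norm_divide)
    then have "Rep_KD \<alpha> analytic_on {1 / v}"
      by (intro D_form_analytic Rep_KD_D_form)
    moreover have "(\<lambda>v. 1 / v) analytic_on {v}"
      using False by (intro analytic_intros) auto
    ultimately have "(Rep_KD \<alpha> \<circ> (\<lambda>v. 1 / v)) analytic_on {v}"
      by (intro analytic_on_compose) auto
    then have "v_coeff (Rep_KD \<alpha>) analytic_on {v}"
      using False unfolding v_coeff_def[abs_def] o_def by (intro analytic_intros) auto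
    then show ?thesis
      unfolding vfun_def by (auto intro: remove_sings_analytic_on)
  qed
  then show "vfun \<alpha> analytic_on {v}"
    and "vfun \<alpha> v = (if v = 0 then form_coeff (Rep_KD \<alpha>) Pole
                     else - form_coeff (Rep_KD \<alpha>) (Pt (1 / v)) / v\<^sup>2)"
    by (auto simp: v_coeff_def vfun_def)
qed

lemma vfun_linear:
  assumes "norm v \<le> 1"
  shows "vfun (\<alpha> + \<beta>) v = vfun \<alpha> v + vfun \<beta> v" "vfun (scaleKD c \<alpha>) v = c * vfun \<alpha> v"
proof -
  have "v \<noteq> 0 \<Longrightarrow> Pt (1 / v) \<notin> discD" "Pole \<notin> discD"
    using assms by (auto simp: discD_def norm_divide)
  then show "vfun (\<alpha> + \<beta>) v = vfun \<alpha> v + vfun \<beta> v" "vfun (scaleKD c \<alpha>) v = c * vfun \<alpha> v"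
    unfolding vfun_eq[OF assms]
    by (simp_all add: form_coeff_add form_coeff_scale add_divide_distrib
        diff_divide_distrib del: form_coeff.simps)
qed

lemma vfun_e_form:
  assumes "norm a < 1" "norm v < 1"
  shows "vfun (e_form k a) v = of_nat (Suc k) * v ^ k / (1 - a * v) ^ (k + 2)"
proof -
  let ?h = "\<lambda>v. of_nat (Suc k) * v ^ k / (1 - a * v) ^ (k + 2)"
  have eq: "v_coeff (Rep_KD (e_form k a)) v = ?h v" if "v \<noteq> 0" for v
  proof -
    have "1 / v - a = (1 - a * v) / v"
      using that by (simp add: field_simps)
    then show ?thesis
      using that by (simp add: v_coeff_def Rep_e_form[OF assms(1)] power_divide power_add
          power2_eq_square del: of_nat_Suc)
  qed
  have "1 - a * v \<noteq> 0"
  proof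
    assume "1 - a * v = 0"
    then have "norm a * norm v = 1" by (metis norm_mult norm_one right_minus_eq)
    moreover have "norm a * norm v < 1 * 1"
      using assms by (intro mult_strict_mono') auto
    ultimately show False by simp
  qed
  then have "?h \<midarrow>v\<rightarrow> ?h v"
    by (intro tendsto_intros) auto
  then have "v_coeff (Rep_KD (e_form k a)) \<midarrow>v\<rightarrow> ?h v"
  proof (rule Lim_transform_eventually)
    show "eventually (\<lambda>v. ?h v = v_coeff (Rep_KD (e_form k a)) v) (at v)"
      using eventually_neq_at_within[of 0 v UNIV] by eventually_elim (simp add: eq)
  qed
  then show ?thesis
    unfolding vfun_def by (rule remove_sings_eqI)
qed

text \<open>
  The Taylor series of \<open>vfun \<alpha>\<close> at the pole of \<open>u\<close>.
\<close>

definition vfps :: "KD \<Rightarrow> complex fps" where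
  "vfps \<alpha> = fps_expansion (vfun \<alpha>) 0"

text \<open>
  Holomorphy beyond the closed unit disc makes the radius of convergence exceed \<open>1\<close>; the Taylor
  coefficients are therefore absolutely summable.
\<close>

lemma
  shows conv_radius_vfps: "fps_conv_radius (vfps \<alpha>) > 1"
    and eval_vfps: "norm v \<le> 1 \<Longrightarrow> eval_fps (vfps \<alpha>) v = vfun \<alpha> v"
    and has_fps_expansion_vfun: "vfun \<alpha> has_fps_expansion vfps \<alpha>"
proof -
  have "vfun \<alpha> analytic_on cball 0 1"
    using vfun_analytic by (subst analytic_on_analytic_at) auto
  then obtain S where S: "open S" "cball 0 1 \<subseteq> S" "vfun \<alpha> holomorphic_on S"
    unfolding analytic_on_holomorphic by blast
  obtain e where e: "e > 0" "(\<Union>x\<in>cball 0 1. ball x e) \<subseteq> S"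
    using compact_subset_open_imp_ball_epsilon_subset[OF compact_cball S(1,2)] by blast
  have "ball 0 (1 + e) \<subseteq> S"
  proof
    fix x :: complex assume x: "x \<in> ball 0 (1 + e)"
    show "x \<in> S"
    proof (cases "norm x \<le> 1")
      case False
      \<comment> \<open>\<open>x\<close> has distance less than \<open>e\<close> from its radial projection to the unit circle\<close>
      have "norm x \<noteq> 0"
        using False by linarith
      then have "(norm x - 1) / norm x = 1 - inverse (norm x)"
        by (simp add: field_simps)
      then have "x - x /\<^sub>R norm x = ((norm x - 1) / norm x) *\<^sub>R x"
        by (simp add: scaleR_left_diff_distrib)
      then have "dist (x /\<^sub>R norm x) x = norm x - 1"
        using False \<open>norm x \<noteq> 0\<close> by (simp add: dist_norm norm_minus_commute)
      moreover have "norm (x /\<^sub>R norm x) \<le> 1"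
        using \<open>norm x \<noteq> 0\<close> by simp
      ultimately show ?thesis
        using x by (intro subsetD[OF e(2)] UN_I[of "x /\<^sub>R norm x"]) (auto simp del: norm_scaleR)
    qed (use S(2) in auto)
  qed
  then have holo: "vfun \<alpha> holomorphic_on eball 0 (ereal (1 + e))"
    using S(3) by (auto intro: holomorphic_on_subset)
  have "ereal (1 + e) \<le> fps_conv_radius (vfps \<alpha>)"
    unfolding vfps_def by (rule conv_radius_fps_expansion[OF holo])
  moreover have "1 < ereal (1 + e)"
    using e(1) by (simp add: one_ereal_def)
  ultimately show "fps_conv_radius (vfps \<alpha>) > 1"
    by (rule less_le_trans[rotated])
  show "eval_fps (vfps \<alpha>) v = vfun \<alpha> v" if "norm v \<le> 1"
    unfolding vfps_def using eval_fps_expansion'[OF holo, of v] that e(1) by simp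
  show "vfun \<alpha> has_fps_expansion vfps \<alpha>"
    unfolding vfps_def using S by (intro has_fps_expansion_fps_expansion[of S]) auto
qed

lemma conv_radius_vfps_gt: "norm a < 1 \<Longrightarrow> ereal (norm a) < fps_conv_radius (vfps \<alpha>)"
  by (rule less_trans[OF _ conv_radius_vfps]) (simp add: one_ereal_def)

lemma vfps_eqI:
  assumes "\<And>v. norm v < 1 \<Longrightarrow> f v = vfun \<alpha> v" "f has_fps_expansion F"
  shows "vfps \<alpha> = F"
proof -
  have "eventually (\<lambda>v::complex. v \<in> ball 0 1) (nhds 0)"
    by (intro eventually_nhds_in_open) auto
  then have "eventually (\<lambda>v. f v = vfun \<alpha> v) (nhds 0)"
    by eventually_elim (simp add: assms(1))
  then have "vfun \<alpha> has_fps_expansion F"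
    using assms(2) has_fps_expansion_cong by blast
  with has_fps_expansion_vfun show ?thesis
    by (rule fps_expansion_unique_complex)
qed

lemma vfps_linear:
  "vfps (\<alpha> + \<beta>) = vfps \<alpha> + vfps \<beta>" "vfps (scaleKD c \<alpha>) = fps_const c * vfps \<alpha>"
proof -
  show "vfps (\<alpha> + \<beta>) = vfps \<alpha> + vfps \<beta>"
    by (rule vfps_eqI[OF _ has_fps_expansion_add[OF has_fps_expansion_vfun has_fps_expansion_vfun]])
       (simp add: vfun_linear)
  show "vfps (scaleKD c \<alpha>) = fps_const c * vfps \<alpha>"
    by (rule vfps_eqI[OF _ has_fps_expansion_cmult_left[OF has_fps_expansion_vfun]])
       (simp add: vfun_linear)
qed

lemma vfps_e_form:
  assumes "norm a < 1"
  shows "fps_nth (vfps (e_form k a)) n = of_nat (Suc n) * of_nat (n choose k) * a ^ (n - k)"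
proof -
  have "vfps (e_form k a) = fps_const (of_nat (Suc k)) * fps_X ^ k *
          inverse ((1 - fps_const a * fps_X) ^ (k + 2))"
  proof (rule vfps_eqI)
    show "(\<lambda>v. of_nat (Suc k) * v ^ k * inverse ((1 - a * v) ^ (k + 2))) has_fps_expansion
        fps_const (of_nat (Suc k)) * fps_X ^ k * inverse ((1 - fps_const a * fps_X) ^ (k + 2))"
      by (intro fps_expansion_intros) simp_all
  qed (simp add: vfun_e_form[OF assms] field_simps)
  also have inv: "inverse ((1 - fps_const a * fps_X) ^ (k + 2)) =
      Abs_fps (\<lambda>j. of_nat ((k + 2 + j - 1) choose j) * a ^ j)"
    by (rule one_minus_const_fps_X_neg_power') simp
  finally have "vfps (e_form k a) = fps_const (of_nat (Suc k)) * fps_X ^ k *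
      Abs_fps (\<lambda>j. of_nat ((k + 2 + j - 1) choose j) * a ^ j)" .
  also have "fps_nth \<dots> n = of_nat (Suc n) * of_nat (n choose k) * a ^ (n - k)"
  proof (cases "n < k")
    case False
    have "(k + 2 + (n - k) - 1) choose (n - k) = Suc n choose Suc k"
      using False binomial_symmetric[of "Suc k" "Suc n"] by simp
    moreover have "(of_nat (Suc k) * of_nat (Suc n choose Suc k) :: complex) =
        of_nat (Suc n) * of_nat (n choose k)"
      by (metis Suc_times_binomial_eq of_nat_mult mult.commute)
    ultimately show ?thesis
      using False
      by (simp add: mult.assoc fps_X_power_mult_nth del: of_nat_Suc binomial_Suc_Suc)
  qed (simp add: mult.assoc fps_X_power_mult_nth)
  finally show ?thesis .
qed

text \<open>
  The Bergman inner product of \<open>vfun \<alpha>\<close> and \<open>vfun \<beta>\<close> on the unit disc, up to a factor \<open>\<pi>\<close>: the monomials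
  \<open>v ^ n\<close> are orthogonal, of squared norm \<open>\<pi> / (n + 1)\<close>.
\<close>

definition bergman :: "KD \<Rightarrow> KD \<Rightarrow> complex" where
  "bergman \<alpha> \<beta> = suminf (\<lambda>n. cnj (fps_nth (vfps \<alpha>) n) * fps_nth (vfps \<beta>) n / of_nat (Suc n))"

lemma summable_vfps: "summable (\<lambda>n. norm (fps_nth (vfps \<alpha>) n))"
  using norm_summable_fps[of 1 "vfps \<alpha>"] conv_radius_vfps[of \<alpha>] by (simp add: one_ereal_def)

lemma summable_bergman:
  "summable (\<lambda>n. cnj (fps_nth (vfps \<alpha>) n) * fps_nth (vfps \<beta>) n / of_nat (Suc n))"
proof -
  have "Bseq (\<lambda>n. norm (fps_nth (vfps \<beta>) n))"
    using summable_vfps[of \<beta>] summable_LIMSEQ_zero convergentI Bseq_eq_bounded convergent_imp_Bseq by blast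
  then obtain M where M: "\<And>n. norm (fps_nth (vfps \<beta>) n) \<le> M"
    by (auto simp: Bseq_def)
  show ?thesis
  proof (rule summable_comparison_test')
    show "summable (\<lambda>n. norm (fps_nth (vfps \<alpha>) n) * M)"
      by (intro summable_mult2 summable_vfps)
    show "norm (cnj (fps_nth (vfps \<alpha>) n) * fps_nth (vfps \<beta>) n / of_nat (Suc n)) \<le>
        norm (fps_nth (vfps \<alpha>) n) * M" for n
    proof -
      have "norm (cnj (fps_nth (vfps \<alpha>) n) * fps_nth (vfps \<beta>) n / of_nat (Suc n)) \<le>
          norm (fps_nth (vfps \<alpha>) n) * norm (fps_nth (vfps \<beta>) n) / 1"
        unfolding norm_divide norm_mult norm_of_nat by (intro frac_le) auto
      also have "\<dots> \<le> norm (fps_nth (vfps \<alpha>) n) * M"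
        using M by (simp add: mult_left_mono)
      finally show ?thesis .
    qed
  qed
qed

lemma bergman_cnj: "bergman \<beta> \<alpha> = cnj (bergman \<alpha> \<beta>)"
  using bounded_linear.suminf[OF bounded_linear_cnj summable_bergman[of \<alpha> \<beta>]]
  by (simp add: bergman_def mult.commute)

lemma bergman_add: "bergman \<alpha> (\<beta> + \<gamma>) = bergman \<alpha> \<beta> + bergman \<alpha> \<gamma>"
  unfolding bergman_def suminf_add[OF summable_bergman summable_bergman]
  by (simp add: vfps_linear algebra_simps add_divide_distrib)

lemma bergman_scale: "bergman \<alpha> (scaleKD c \<beta>) = c * bergman \<alpha> \<beta>"
  unfolding bergman_def suminf_mult[OF summable_bergman, symmetric]
  by (simp add: vfps_linear mult_ac)

text \<open>
  The factor \<open>n + 1\<close> in the coefficients of \<open>e_form k a\<close> cancels the weight of \<open>bergman\<close>. The result is the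
  coefficient of \<open>w ^ k\<close> in \<open>cnj (vfun \<alpha> (cnj (a + w)))\<close>, by \<open>has_fps_expansion_recentre\<close>; so
  \<open>e_form 0 a\<close> is a reproducing kernel.
\<close>

lemma bergman_e_form_eq:
  assumes "norm a < 1"
  shows "bergman \<alpha> (e_form k a) =
           suminf (\<lambda>n. fps_nth (cnj_fps (vfps \<alpha>)) n * of_nat (n choose k) * a ^ (n - k))"
  unfolding bergman_def by (simp add: vfps_e_form[OF assms] mult_ac del: of_nat_Suc)

lemma bergman_e_form_0:
  assumes "norm a < 1"
  shows "bergman \<alpha> (e_form 0 a) = cnj (vfun \<alpha> (cnj a))"
proof -
  have "ereal (norm a) < fps_conv_radius (vfps \<alpha>)"
    using assms by (simp add: conv_radius_vfps_gt)
  from eval_cnj_fps[OF this] show ?thesis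
    using assms by (simp add: bergman_e_form_eq eval_vfps) (simp add: eval_fps_def)
qed

lemma bergman_e_form_expansion:
  assumes "norm a < 1"
  shows "(\<lambda>w. bergman \<alpha> (e_form 0 (a + w))) has_fps_expansion
           Abs_fps (\<lambda>k. bergman \<alpha> (e_form k a))"
proof (rule iffD1[OF has_fps_expansion_cong[OF _ refl]])
  have "ereal (norm a) < fps_conv_radius (cnj_fps (vfps \<alpha>))"
    using assms by (simp add: conv_radius_vfps_gt)
  from has_fps_expansion_recentre[OF this]
  show "(\<lambda>w. eval_fps (cnj_fps (vfps \<alpha>)) (a + w)) has_fps_expansion
      Abs_fps (\<lambda>k. bergman \<alpha> (e_form k a))"
    unfolding bergman_e_form_eq[OF assms] .
  have "eventually (\<lambda>w. w \<in> ball 0 (1 - norm a)) (nhds (0::complex))"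
    using assms by (intro eventually_nhds_in_open) auto
  then show "eventually (\<lambda>w. eval_fps (cnj_fps (vfps \<alpha>)) (a + w) = bergman \<alpha> (e_form 0 (a + w)))
      (nhds 0)"
  proof eventually_elim
    case (elim w)
    then have "norm (a + w) < 1"
      using norm_triangle_ineq[of a w] by simp
    then show ?case
      by (simp add: bergman_e_form_eq) (simp add: eval_fps_def)
  qed
qed

section \<open>Existence\<close>

interpretation bergman: hermitian_KD bergman
  by unfold_locales (rule bergman_add bergman_scale bergman_cnj)+

lemma hermitian_structureD:
  assumes "hermitian_structure B"
  shows "B \<phi> (\<psi> + \<psi>') = B \<phi> \<psi> + B \<phi> \<psi>'" "B \<phi> (scaleW c \<psi>) = c * B \<phi> \<psi>"
    "B (\<phi> + \<phi>') \<psi> = B \<phi> \<psi> + B \<phi>' \<psi>" "B (scaleW c \<phi>) \<psi> = cnj c * B \<phi> \<psi>"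
    "B 0 \<psi> = 0" "B \<phi> 0 = 0"
proof -
  show *: "B \<phi> (\<psi> + \<psi>') = B \<phi> \<psi> + B \<phi> \<psi>'" "B \<phi> (scaleW c \<psi>) = c * B \<phi> \<psi>"
    "B (\<phi> + \<phi>') \<psi> = B \<phi> \<psi> + B \<phi>' \<psi>" "B (scaleW c \<phi>) \<psi> = cnj c * B \<phi> \<psi>" for \<phi> \<psi> \<phi>' \<psi>' c
    using assms unfolding hermitian_structure_def by blast+
  show "B 0 \<psi> = 0" "B \<phi> 0 = 0"
    using *(2)[of \<phi> 0 0] *(4)[of 0 0 \<psi>] by (simp_all add: scaleW_simps)
qed

lemma hermitian_structure_cnj: "hermitian_structure B \<Longrightarrow> B \<psi> \<phi> = cnj (B \<phi> \<psi>)"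
  unfolding hermitian_structure_def by blast

lemma Cinv_discD_mem: "z \<in> discD \<Longrightarrow> Cinv z \<in> discD'" "z \<in> discD' \<Longrightarrow> Cinv z \<in> discD"
proof -
  show "z \<in> discD \<Longrightarrow> Cinv z \<in> discD'"
    using Cinv_discD by blast
  assume "z \<in> discD'"
  then obtain y where "y \<in> discD" "z = Cinv y"
    using Cinv_discD by blast
  then show "Cinv z \<in> discD" by simp
qed

lemma discD'_not_discD: "z \<in> discD' \<Longrightarrow> z \<notin> discD"
  by (auto simp: discD_def discD'_def)

lemma bergman_e_form_left:
  assumes "Pt a \<in> discD"
  shows "bergman (e_form 0 a) \<alpha> = cnj (C_pull (Pt a)) * form_coeff (Rep_KD \<alpha>) (Cinv (Pt a))"
proof -
  have a: "norm a < 1" using assms by (simp add: discD_def)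
  then have "bergman (e_form 0 a) \<alpha> = vfun \<alpha> (cnj a)"
    using bergman_cnj[of "e_form 0 a" \<alpha>] by (simp add: bergman_e_form_0)
  then show ?thesis
    using a by (cases "a = 0")
      (simp_all add: vfun_eq C_pull_simps del: form_coeff.simps)
qed

text \<open>
  Both sides are derivations, so agreement on \<open>KD\<close> suffices.
\<close>

lemma ann_e_form:
  assumes "Pt a \<in> discD"
  shows "bergman.ann (e_form 0 a) \<phi> =
           scaleW (- cnj (C_pull (Pt a))) (i_op (Cinv (Pt a)) \<phi>)"
proof -
  have "Cinv (Pt a) \<notin> discD"
    using assms Cinv_discD_mem discD'_not_discD by blast
  note i = derivationD[OF i_op_derivation(1)[OF this]] i_op_derivation(3)[OF this]
  show ?thesis
    by (induction \<phi> rule: WD_induct)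
       (simp_all add: bergman.ann_simps i scaleW_simps bergman_e_form_left[OF assms] mult.commute
          del: Cinv.simps form_coeff.simps)
qed

text \<open>
  By \<open>formW_inclW_right\<close> this says that the pairing with \<open>e(z)\<psi>\<close> may be expanded termwise. In the
  induction on \<open>\<phi>\<close>, the derivation rule reduces to the case of \<open>KD\<close>, \<open>bergman_e_form_expansion\<close>.
\<close>

lemma formW_ann_expansion:
  assumes "norm a < 1"
  shows "(\<lambda>w. bergman.formW (bergman.ann (e_form 0 (a + w)) \<phi>) \<psi>) has_fps_expansion
           Abs_fps (\<lambda>n. bergman.formW (bergman.ann (e_form n a) \<phi>) \<psi>)"
proof (induction \<phi> arbitrary: \<psi> rule: WD_induct)
  case one
  have "Abs_fps (\<lambda>n. 0 :: complex) = 0" by (simp add: fps_eq_iff)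
  then show ?case by (simp add: bergman.ann_simps)
next
  case (incl_mult \<alpha> \<phi>)
  have eq: "bergman.formW (bergman.ann \<beta> (inclW \<alpha> * \<phi>)) \<psi> =
      bergman \<alpha> \<beta> * bergman.formW \<phi> \<psi> + bergman.formW (bergman.ann \<beta> \<phi>) (bergman.ann \<alpha> \<psi>)" for \<beta>
    by (simp add: bergman.ann_simps bergman.formW_antilinear_left scaleW_simps
        bergman.formW_inclW_left bergman_cnj[of \<alpha> \<beta>])
  have "(\<lambda>w. bergman \<alpha> (e_form 0 (a + w)) * bergman.formW \<phi> \<psi> +
        bergman.formW (bergman.ann (e_form 0 (a + w)) \<phi>) (bergman.ann \<alpha> \<psi>)) has_fps_expansion
      Abs_fps (\<lambda>n. bergman \<alpha> (e_form n a)) * fps_const (bergman.formW \<phi> \<psi>) +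
      Abs_fps (\<lambda>n. bergman.formW (bergman.ann (e_form n a) \<phi>) (bergman.ann \<alpha> \<psi>))"
    by (intro has_fps_expansion_add has_fps_expansion_cmult_right bergman_e_form_expansion
        assms incl_mult)
  also have "Abs_fps (\<lambda>n. bergman \<alpha> (e_form n a)) * fps_const (bergman.formW \<phi> \<psi>) +
      Abs_fps (\<lambda>n. bergman.formW (bergman.ann (e_form n a) \<phi>) (bergman.ann \<alpha> \<psi>)) =
      Abs_fps (\<lambda>n. bergman \<alpha> (e_form n a) * bergman.formW \<phi> \<psi> +
        bergman.formW (bergman.ann (e_form n a) \<phi>) (bergman.ann \<alpha> \<psi>))"
    by (simp add: fps_eq_iff)
  finally show ?case
    unfolding eq .
next
  case (add \<phi> \<phi>')
  have "Abs_fps (\<lambda>n. f n + g n) = Abs_fps f + Abs_fps g" for f g :: "nat \<Rightarrow> complex"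
    by (simp add: fps_eq_iff)
  then show ?case
    using has_fps_expansion_add[OF add[of \<psi>]]
    by (simp add: bergman.ann_simps bergman.formW_antilinear_left)
next
  case (scale c \<phi>)
  have "Abs_fps (\<lambda>n. d * f n) = fps_const d * Abs_fps f" for f :: "nat \<Rightarrow> complex" and d
    by (simp add: fps_eq_iff)
  then show ?case
    using has_fps_expansion_cmult_left[OF scale[of \<psi>], of "cnj c"]
    by (simp add: bergman.ann_simps bergman.formW_antilinear_left)
qed

lemma adjoint_e_formW: "adjoint_e bergman.formW \<phi> \<psi>"
proof -
  have "e_section_right bergman.formW \<phi> \<psi>"
    unfolding e_section_right_def e_hat_def e_op_def bergman.formW_inclW_right
    using formW_ann_expansion by (simp add: discD_def)
  moreover have "bergman.formW \<phi> (e_hat z \<psi>) = - (C_pull z * bergman.formW (i_op (Cinv z) \<phi>) \<psi>)"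
    if z: "z \<in> discD" for z
  proof -
    obtain a where "z = Pt a" using z by (auto simp: discD_def)
    then show ?thesis
      using z by (simp add: e_hat_def e_op_def bergman.formW_inclW_right ann_e_form
          bergman.formW_antilinear_left del: Cinv.simps)
  qed
  ultimately show ?thesis
    by (simp add: adjoint_e_def)
qed

lemma C_pull_Cinv:
  assumes "z \<in> discD'"
  shows "C_pull z * cnj (C_pull (Cinv z)) = 1"
  using assms by (auto simp: discD'_def C_pull_simps field_simps)

text \<open>
  Condition (ii) at \<open>z\<close> is the complex conjugate of condition (i) at \<open>C(z)\<close>, with arguments exchanged.
\<close>

lemma adjoint_i_if_adjoint_e:
  assumes B: "hermitian_structure B" and e: "adjoint_e B \<psi> \<phi>"
  shows "adjoint_i B \<phi> \<psi>"
  unfolding adjoint_i_def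
proof (intro conjI ballI)
  note cnj_eq = hermitian_structure_cnj[OF B, of _ \<psi>]
  show "e_section_left B \<phi> \<psi>"
    unfolding e_section_left_def cnj_eq
  proof (intro allI impI)
    fix a assume "Pt a \<in> discD"
    then have "(\<lambda>w. B \<psi> (e_hat (Pt (a + w)) \<phi>)) has_fps_expansion
        Abs_fps (\<lambda>n. B \<psi> (e_op n a \<phi>))"
      using e by (simp add: adjoint_e_def e_section_right_def)
    from has_fps_expansion_cnj[OF this]
    show "(\<lambda>w. cnj (B \<psi> (e_hat (Pt (a + cnj w)) \<phi>))) has_fps_expansion
        Abs_fps (\<lambda>n. cnj (B \<psi> (e_op n a \<phi>)))"
      by (simp add: cnj_fps_def)
  qed
  fix z assume z: "z \<in> discD'"
  then have "B \<psi> (e_hat (Cinv z) \<phi>) = - (C_pull (Cinv z) * B (i_op z \<psi>) \<phi>)"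
    using e Cinv_discD_mem(2)[OF z] by (simp add: adjoint_e_def)
  then have "B (e_hat (Cinv z) \<phi>) \<psi> = - (cnj (C_pull (Cinv z)) * B \<phi> (i_op z \<psi>))"
    unfolding cnj_eq[of "e_hat (Cinv z) \<phi>"] hermitian_structure_cnj[OF B, of \<phi>] by simp
  then have "- (C_pull z * B (e_hat (Cinv z) \<phi>) \<psi>) =
      (C_pull z * cnj (C_pull (Cinv z))) * B \<phi> (i_op z \<psi>)"
    by simp
  then show "B \<phi> (i_op z \<psi>) = - (C_pull z * B (e_hat (Cinv z) \<phi>) \<psi>)"
    using C_pull_Cinv[OF z] by simp
qed

section \<open>Uniqueness\<close>

text \<open>
  The values \<open>B \<phi> (e_hat z \<psi>)\<close> are prescribed by \<open>eq\<close>, their Taylor coefficients in \<open>z\<close> are the values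
  \<open>B \<phi> (e_form n a * \<psi>)\<close>, and the forms \<open>e_form n a\<close> span \<open>KD\<close>.
\<close>

lemma adjoint_e_determines:
  assumes B: "hermitian_structure B" "\<And>\<phi> \<psi>. adjoint_e B \<phi> \<psi>"
    and B': "hermitian_structure B'" "\<And>\<phi> \<psi>. adjoint_e B' \<phi> \<psi>"
    and eq: "\<And>z. z \<in> discD \<Longrightarrow> B (i_op (Cinv z) \<phi>) \<psi> = B' (i_op (Cinv z) \<phi>) \<psi>"
  shows "B \<phi> (inclW \<alpha> * \<psi>) = B' \<phi> (inclW \<alpha> * \<psi>)"
proof (induction \<alpha> rule: KD_induct)
  case zero
  have "inclW 0 = 0" using inclW_add[of 0 0] by simp
  then show ?case by (simp add: hermitian_structureD[OF B(1)] hermitian_structureD[OF B'(1)])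
next
  case (e_form n a)
  have hat: "B \<phi> (e_hat z \<psi>) = B' \<phi> (e_hat z \<psi>)" if "z \<in> discD" for z
    using B(2) B'(2) eq[OF that] that by (simp add: adjoint_e_def)
  have B_exp: "(\<lambda>w. B \<phi> (e_hat (Pt (a + w)) \<psi>)) has_fps_expansion Abs_fps (\<lambda>n. B \<phi> (e_op n a \<psi>))"
    and B'_exp: "(\<lambda>w. B' \<phi> (e_hat (Pt (a + w)) \<psi>)) has_fps_expansion Abs_fps (\<lambda>n. B' \<phi> (e_op n a \<psi>))"
    using B(2)[of \<phi> \<psi>] B'(2)[of \<phi> \<psi>] e_form
    by (simp_all add: adjoint_e_def e_section_right_def discD_def)
  have "eventually (\<lambda>w. w \<in> ball 0 (1 - norm a)) (nhds (0::complex))"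
    using e_form by (intro eventually_nhds_in_open) auto
  then have "eventually (\<lambda>w. B \<phi> (e_hat (Pt (a + w)) \<psi>) = B' \<phi> (e_hat (Pt (a + w)) \<psi>)) (nhds 0)"
  proof eventually_elim
    case (elim w)
    then have "norm (a + w) < 1"
      using norm_triangle_ineq[of a w] by simp
    then show ?case by (intro hat) (simp add: discD_def)
  qed
  then have "(\<lambda>w. B' \<phi> (e_hat (Pt (a + w)) \<psi>)) has_fps_expansion Abs_fps (\<lambda>n. B \<phi> (e_op n a \<psi>))"
    using B_exp by (rule iffD1[OF has_fps_expansion_cong[OF _ refl]])
  then have "Abs_fps (\<lambda>n. B \<phi> (e_op n a \<psi>)) = Abs_fps (\<lambda>n. B' \<phi> (e_op n a \<psi>))"
    using B'_exp by (rule fps_expansion_unique_complex)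
  then have "fps_nth (Abs_fps (\<lambda>n. B \<phi> (e_op n a \<psi>))) n =
      fps_nth (Abs_fps (\<lambda>n. B' \<phi> (e_op n a \<psi>))) n"
    by (rule arg_cong)
  then show ?case
    by (simp add: e_op_def)
next
  case (add \<alpha> \<beta>)
  then show ?case
    by (simp only: inclW_add distrib_right hermitian_structureD[OF B(1)] hermitian_structureD[OF B'(1)])
next
  case (scale c \<alpha>)
  then show ?case
    by (simp only: inclW_scale scaleW_simps hermitian_structureD[OF B(1)] hermitian_structureD[OF B'(1)])
qed

lemma adjoint_e_unique:
  assumes B: "hermitian_structure B" "\<And>\<phi> \<psi>. adjoint_e B \<phi> \<psi>"
    and B': "hermitian_structure B'" "\<And>\<phi> \<psi>. adjoint_e B' \<phi> \<psi>"
    and vac: "B 1 1 = B' 1 1"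
  shows "B = B'"
proof -
  note determines = adjoint_e_determines[OF B B']
  note D = hermitian_structureD[OF B(1)] hermitian_structureD[OF B'(1)]
  have i1: "i_op (Cinv z) 1 = 0" if "z \<in> discD" for z
    using i_op_derivation(2) Cinv_discD_mem(1)[OF that] discD'_not_discD by blast
  have one: "B 1 \<psi> = B' 1 \<psi>" for \<psi>
  proof (induction \<psi> rule: WD_induct)
    case (incl_mult \<alpha> \<psi>)
    show ?case by (rule determines) (simp add: i1 D)
  qed (simp_all add: vac D)
  have "B \<phi> \<psi> = B' \<phi> \<psi>" for \<phi> \<psi>
  proof (induction \<psi> arbitrary: \<phi> rule: WD_induct)
    case one
    show ?case
      unfolding hermitian_structure_cnj[OF B(1), of \<phi> 1] hermitian_structure_cnj[OF B'(1), of \<phi> 1]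
        \<open>B 1 \<phi> = B' 1 \<phi>\<close> ..
  next
    case (incl_mult \<alpha> \<psi>)
    then show ?case by (intro determines)
  qed (simp_all add: D)
  then show ?thesis by blast
qed

section \<open>The conditions in the frame \<open>du\<close>\<close>

text \<open>
  Continuity of \<open>i(z)\<phi>\<close> at the pole of \<open>u\<close>; the factor \<open>- 1 / w\<^sup>2\<close> changes the frame from \<open>du\<close> to \<open>dv\<close>. The
  statement ranges over all linear functionals \<open>L\<close>, because the induction on \<open>\<phi>\<close> replaces \<open>L\<close> by
  \<open>L (inclW \<alpha> * _)\<close>.
\<close>

lemma i_op_tendsto_Pole:
  assumes "\<And>\<phi> \<psi>. L (\<phi> + \<psi>) = L \<phi> + L \<psi>" "\<And>c \<phi>. L (scaleW c \<phi>) = c * L \<phi>"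
  shows "((\<lambda>w. L (i_op (Pt (1 / w)) \<phi>) / w\<^sup>2) \<longlongrightarrow> - L (i_op Pole \<phi>)) (at 0)"
  using assms
proof (induction \<phi> arbitrary: L rule: WD_induct)
  have Pole: "Pole \<notin> discD" by (simp add: discD_def)
  have "eventually (\<lambda>w::complex. w \<in> ball 0 1 - {0}) (at 0)"
    by (intro eventually_at_in_open) auto
  then have Pt: "eventually (\<lambda>w. Pt (1 / w) \<notin> discD) (at 0)"
    by eventually_elim (auto simp: discD_def norm_divide)
  note i = derivationD[OF i_op_derivation(1)] i_op_derivation(3)
  {
    case one
    have "L 0 = 0" using one(2)[of 0 0] by (simp add: scaleW_simps)
    show ?case
    proof (rule Lim_transform_eventually)
      show "((\<lambda>_. 0) \<longlongrightarrow> - L (i_op Pole 1)) (at 0)"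
        by (simp add: i[OF Pole] \<open>L 0 = 0\<close>)
      show "eventually (\<lambda>w. 0 = L (i_op (Pt (1 / w)) 1) / w\<^sup>2) (at 0)"
        using Pt by eventually_elim (simp add: i \<open>L 0 = 0\<close>)
    qed
  next
    case (incl_mult \<alpha> \<phi>)
    have "((\<lambda>w. L (inclW \<alpha> * i_op (Pt (1 / w)) \<phi>) / w\<^sup>2) \<longlongrightarrow>
        - L (inclW \<alpha> * i_op Pole \<phi>)) (at 0)"
      by (rule incl_mult.IH) (simp_all add: distrib_left scaleW_simps incl_mult.prems)
    from tendsto_add[OF tendsto_mult_right[OF D_form_tendsto_Pole[OF Rep_KD_D_form[of \<alpha>]]] this]
    have lim: "((\<lambda>w. v_coeff (Rep_KD \<alpha>) w * L \<phi> + L (inclW \<alpha> * i_op (Pt (1 / w)) \<phi>) / w\<^sup>2) \<longlongrightarrow>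
        form_coeff (Rep_KD \<alpha>) Pole * L \<phi> + - L (inclW \<alpha> * i_op Pole \<phi>)) (at 0)" .
    have "form_coeff (Rep_KD \<alpha>) Pole * L \<phi> + - L (inclW \<alpha> * i_op Pole \<phi>) =
        - L (i_op Pole (inclW \<alpha> * \<phi>))"
      by (simp add: i[OF Pole] incl_mult.prems scaleW_simps del: form_coeff.simps)
    from lim[unfolded this] show ?case
    proof (rule Lim_transform_eventually)
      show "eventually (\<lambda>w. v_coeff (Rep_KD \<alpha>) w * L \<phi> + L (inclW \<alpha> * i_op (Pt (1 / w)) \<phi>) / w\<^sup>2 =
          L (i_op (Pt (1 / w)) (inclW \<alpha> * \<phi>)) / w\<^sup>2) (at 0)"
        using Pt
      proof eventually_elim
        case (elim w)
        show ?case
          by (simp add: i[OF elim] incl_mult.prems scaleW_simps v_coeff_def add_divide_distrib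
              diff_divide_distrib)
      qed
    qed
  next
    case (add \<phi> \<phi>')
    show ?case
    proof (rule Lim_transform_eventually)
      show "((\<lambda>w. L (i_op (Pt (1 / w)) \<phi>) / w\<^sup>2 + L (i_op (Pt (1 / w)) \<phi>') / w\<^sup>2) \<longlongrightarrow>
          - L (i_op Pole (\<phi> + \<phi>'))) (at 0)"
        using tendsto_add[OF add.IH(1)[of L] add.IH(2)[of L]]
        by (simp add: i[OF Pole] add.prems)
      show "eventually (\<lambda>w. L (i_op (Pt (1 / w)) \<phi>) / w\<^sup>2 + L (i_op (Pt (1 / w)) \<phi>') / w\<^sup>2 =
          L (i_op (Pt (1 / w)) (\<phi> + \<phi>')) / w\<^sup>2) (at 0)"
        using Pt by eventually_elim (simp add: i add.prems add_divide_distrib)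
    qed
  next
    case (scale c \<phi>)
    show ?case
    proof (rule Lim_transform_eventually)
      show "((\<lambda>w. c * (L (i_op (Pt (1 / w)) \<phi>) / w\<^sup>2)) \<longlongrightarrow>
          - L (i_op Pole (scaleW c \<phi>))) (at 0)"
        using tendsto_mult_left[OF scale.IH[of L], of c]
        by (simp add: i[OF Pole] scale.prems)
      show "eventually (\<lambda>w. c * (L (i_op (Pt (1 / w)) \<phi>) / w\<^sup>2) =
          L (i_op (Pt (1 / w)) (scaleW c \<phi>)) / w\<^sup>2) (at 0)"
        using Pt by eventually_elim (simp add: i scale.prems)
    qed
  }
qed

lemma has_fps_expansion_tendsto:
  fixes f :: "complex \<Rightarrow> complex"
  assumes "f has_fps_expansion F"
  shows "f \<midarrow>0\<rightarrow> f 0"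
  using has_fps_expansion_imp_continuous[OF assms, of UNIV] by (simp add: continuous_within)

text \<open>
  Where \<open>du\<close> is a frame at \<open>z\<close> and at \<open>C(z)\<close>, the two versions of a condition are equivalent since
  \<open>C_pull z = - 1 / u\<^sup>2\<close>. The remaining points \<open>0\<close> and \<open>Pole\<close> are reached by continuity.
\<close>

lemma hat_eq_iff:
  assumes "z \<noteq> Pole" "z \<noteq> Pt 0"
  shows "(u_coord z)\<^sup>2 * x = y \<longleftrightarrow> x = - (C_pull z * y)"
  using assms by (cases z) (auto simp: C_pull_simps field_simps)

lemma adjoint_e_iff:
  assumes B: "hermitian_structure B"
  shows "adjoint_e B \<phi> \<psi> \<longleftrightarrow> adjoint_e_hat B \<phi> \<psi>"
proof -
  have pt: "(u_coord z)\<^sup>2 * B \<phi> (e_hat z \<psi>) = B (i_op (Cinv z) \<phi>) \<psi> \<longleftrightarrow>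
      B \<phi> (e_hat z \<psi>) = - (C_pull z * B (i_op (Cinv z) \<phi>) \<psi>)" if "z \<in> discD - {Pt 0}" for z
    using that by (intro hat_eq_iff) (auto simp: discD_def)
  have "B \<phi> (e_hat (Pt 0) \<psi>) = - B (i_op Pole \<phi>) \<psi>"
    if sec: "e_section_right B \<phi> \<psi>"
      and eq: "\<And>z. z \<in> discD - {Pt 0} \<Longrightarrow>
        (u_coord z)\<^sup>2 * B \<phi> (e_hat z \<psi>) = B (i_op (Cinv z) \<phi>) \<psi>"
  proof (rule LIM_unique)
    have "Pt 0 \<in> discD" by (simp add: discD_def)
    with sec have "(\<lambda>w. B \<phi> (e_hat (Pt (0 + w)) \<psi>)) has_fps_expansion
        Abs_fps (\<lambda>n. B \<phi> (e_op n 0 \<psi>))"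
      unfolding e_section_right_def by blast
    from has_fps_expansion_tendsto[OF this]
    show "(\<lambda>w. B \<phi> (e_hat (Pt w) \<psi>)) \<midarrow>0\<rightarrow> B \<phi> (e_hat (Pt 0) \<psi>)"
      by simp
    have "((\<lambda>w. cnj (B (i_op (Pt (1 / w)) \<phi>) \<psi>) / w\<^sup>2) \<longlongrightarrow> - cnj (B (i_op Pole \<phi>) \<psi>)) (at 0)"
      by (rule i_op_tendsto_Pole) (simp_all add: hermitian_structureD[OF B])
    moreover have "filterlim cnj (at 0) (at (0::complex))"
      using tendsto_cnj[OF tendsto_ident_at, of 0 UNIV]
      by (auto simp: filterlim_at eventually_at_filter)
    ultimately have "((\<lambda>w. cnj (B (i_op (Pt (1 / cnj w)) \<phi>) \<psi>) / (cnj w)\<^sup>2) \<longlongrightarrow>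
        - cnj (B (i_op Pole \<phi>) \<psi>)) (at 0)"
      by (rule filterlim_compose)
    from tendsto_cnj[OF this]
    have "((\<lambda>w. B (i_op (Pt (1 / cnj w)) \<phi>) \<psi> / w\<^sup>2) \<longlongrightarrow> - B (i_op Pole \<phi>) \<psi>) (at 0)"
      by simp
    then show "(\<lambda>w. B \<phi> (e_hat (Pt w) \<psi>)) \<midarrow>0\<rightarrow> - B (i_op Pole \<phi>) \<psi>"
    proof (rule Lim_transform_eventually)
      have "eventually (\<lambda>w::complex. w \<in> ball 0 1 - {0}) (at 0)"
        by (intro eventually_at_in_open) auto
      then show "eventually (\<lambda>w. B (i_op (Pt (1 / cnj w)) \<phi>) \<psi> / w\<^sup>2 = B \<phi> (e_hat (Pt w) \<psi>)) (at 0)"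
      proof eventually_elim
        case (elim w)
        with eq[of "Pt w"] show ?case by (simp add: discD_def field_simps)
      qed
    qed
  qed
  then have "B \<phi> (e_hat z \<psi>) = - (C_pull z * B (i_op (Cinv z) \<phi>) \<psi>)"
    if "adjoint_e_hat B \<phi> \<psi>" "z \<in> discD" for z
    using that pt[of z] by (cases "z = Pt 0") (simp_all add: adjoint_e_hat_def C_pull_simps)
  then show ?thesis
    using pt by (auto simp: adjoint_e_def adjoint_e_hat_def)
qed

lemma adjoint_i_iff:
  assumes B: "hermitian_structure B"
  shows "adjoint_i B \<phi> \<psi> \<longleftrightarrow> adjoint_i_hat B \<phi> \<psi>"
proof -
  have pt: "(u_coord z)\<^sup>2 * B \<phi> (i_op z \<psi>) = B (e_hat (Cinv z) \<phi>) \<psi> \<longleftrightarrow>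
      B \<phi> (i_op z \<psi>) = - (C_pull z * B (e_hat (Cinv z) \<phi>) \<psi>)" if "z \<in> discD' - {Pole}" for z
    using that by (intro hat_eq_iff) (auto simp: discD'_def)
  have "B \<phi> (i_op Pole \<psi>) = - B (e_hat (Pt 0) \<phi>) \<psi>"
    if sec: "e_section_left B \<phi> \<psi>"
      and eq: "\<And>z. z \<in> discD' - {Pole} \<Longrightarrow>
        (u_coord z)\<^sup>2 * B \<phi> (i_op z \<psi>) = B (e_hat (Cinv z) \<phi>) \<psi>"
  proof -
    have "- B \<phi> (i_op Pole \<psi>) = B (e_hat (Pt 0) \<phi>) \<psi>"
    proof (rule LIM_unique)
      show "(\<lambda>w. B \<phi> (i_op (Pt (1 / w)) \<psi>) / w\<^sup>2) \<midarrow>0\<rightarrow> - B \<phi> (i_op Pole \<psi>)"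
        by (rule i_op_tendsto_Pole) (simp_all add: hermitian_structureD[OF B])
      have "Pt 0 \<in> discD" by (simp add: discD_def)
      with sec have "(\<lambda>w. B (e_hat (Pt (0 + cnj w)) \<phi>) \<psi>) has_fps_expansion
          Abs_fps (\<lambda>n. B (e_op n 0 \<phi>) \<psi>)"
        unfolding e_section_left_def by blast
      from has_fps_expansion_tendsto[OF this]
      have "(\<lambda>w. B (e_hat (Pt (cnj w)) \<phi>) \<psi>) \<midarrow>0\<rightarrow> B (e_hat (Pt 0) \<phi>) \<psi>"
        by simp
      then show "(\<lambda>w. B \<phi> (i_op (Pt (1 / w)) \<psi>) / w\<^sup>2) \<midarrow>0\<rightarrow> B (e_hat (Pt 0) \<phi>) \<psi>"
      proof (rule Lim_transform_eventually)
        have "eventually (\<lambda>w::complex. w \<in> ball 0 1 - {0}) (at 0)"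
          by (intro eventually_at_in_open) auto
        then show "eventually (\<lambda>w. B (e_hat (Pt (cnj w)) \<phi>) \<psi> = B \<phi> (i_op (Pt (1 / w)) \<psi>) / w\<^sup>2) (at 0)"
        proof eventually_elim
          case (elim w)
          with eq[of "Pt (1 / w)"] show ?case
            by (simp add: discD'_def norm_divide power_divide)
        qed
      qed
    qed
    then show ?thesis by (metis minus_minus)
  qed
  then have "B \<phi> (i_op z \<psi>) = - (C_pull z * B (e_hat (Cinv z) \<phi>) \<psi>)"
    if "adjoint_i_hat B \<phi> \<psi>" "z \<in> discD'" for z
    using that pt[of z] by (cases "z = Pole") (simp_all add: adjoint_i_hat_def C_pull_simps)
  then show ?thesis
    using pt by (auto simp: adjoint_i_def adjoint_i_hat_def)
qed

section \<open>The hermitian structure\<close>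

theorem proposition7p6:
  shows "(\<exists>!B. hermitian_structure B \<and> B 1 1 = 1 \<and>
            (\<forall>\<phi> \<psi>. adjoint_e B \<phi> \<psi> \<and> adjoint_i B \<phi> \<psi>)) \<and>
         (\<forall>B. hermitian_structure B \<longrightarrow>
            (\<forall>\<phi> \<psi>. (adjoint_e B \<phi> \<psi> \<longleftrightarrow> adjoint_e_hat B \<phi> \<psi>) \<and>
                   (adjoint_i B \<phi> \<psi> \<longleftrightarrow> adjoint_i_hat B \<phi> \<psi>)))"
proof (intro conjI ex1I[of _ bergman.formW] allI impI)
  show "adjoint_i bergman.formW \<phi> \<psi>" for \<phi> \<psi>
    by (intro adjoint_i_if_adjoint_e bergman.hermitian_structure_formW adjoint_e_formW)
  show "B = bergman.formW"
    if "hermitian_structure B \<and> B 1 1 = 1 \<and> (\<forall>\<phi> \<psi>. adjoint_e B \<phi> \<psi> \<and> adjoint_i B \<phi> \<psi>)" for B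
    using that
    by (intro adjoint_e_unique bergman.hermitian_structure_formW adjoint_e_formW)
       (auto simp: bergman.formW_one_left)
qed (simp_all add: bergman.hermitian_structure_formW adjoint_e_formW bergman.formW_one_left
      adjoint_e_iff adjoint_i_iff)

end
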